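(* For every integer $n$ with $n=7$ or $n\geq 11$, the pure flat braid group $\mathrm{PFB}_n$ is not virtually a right-angled Artin group, i.e.\ $\mathrm{PFB}_n$ contains no finite-index subgroup isomorphic to a right-angled Artin group $A(\Gamma)$ for any finite graph $\Gamma$.
   Context: For $n\geq 2$, the flat braid group is $\mathrm{FB}_n=\langle \sigma_1,\ldots,\sigma_{n-1}\mid \sigma_i^2=1\ (1\le i\le n-1),\ [\sigma_i,\sigma_j]=1 \text{ whenever } |i-j|\geq 2\rangle$. The pure flat braid group $\mathrm{PFB}_n$ is the kernel of the homomorphism $\mathrm{FB}_n\to\mathrm{Sym}(n)$ sending $\sigma_i$ to the transposition $(i,i+1)$. For a graph $\Gamma$, the right-angled Artin group is $A(\Gamma)=\langle u\in V(\Gamma)\mid [u,v]=1 \text{ for adjacent } u,v\rangle$. *)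

theory Defs
  imports "HOL-Algebra.Algebra"
begin

text \<open>A letter is a pair (g, b): b = False means the generator g, b = True its inverse.\<close>

type_synonym 'g pword = "('g \<times> bool) list"

definition pwords :: "'g set \<Rightarrow> 'g pword set" where
  "pwords S = {w. \<forall>x \<in> set w. fst x \<in> S}"

inductive pres_eq :: "'g set \<Rightarrow> 'g pword set \<Rightarrow> 'g pword \<Rightarrow> 'g pword \<Rightarrow> bool"
  for S :: "'g set" and R :: "'g pword set" where
  pe_refl: "w \<in> pwords S \<Longrightarrow> pres_eq S R w w"
| pe_sym: "pres_eq S R v w \<Longrightarrow> pres_eq S R w v"
| pe_trans: "pres_eq S R u v \<Longrightarrow> pres_eq S R v w \<Longrightarrow> pres_eq S R u w"
| pe_cancel: "u \<in> pwords S \<Longrightarrow> v \<in> pwords S \<Longrightarrow> g \<in> S \<Longrightarrow>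
     pres_eq S R (u @ [(g, b), (g, \<not> b)] @ v) (u @ v)"
| pe_rel: "u \<in> pwords S \<Longrightarrow> v \<in> pwords S \<Longrightarrow> r \<in> R \<Longrightarrow> r \<in> pwords S \<Longrightarrow>
     pres_eq S R (u @ r @ v) (u @ v)"

definition pclass :: "'g set \<Rightarrow> 'g pword set \<Rightarrow> 'g pword \<Rightarrow> 'g pword set" where
  "pclass S R w = {v. pres_eq S R w v}"

definition presented_group :: "'g set \<Rightarrow> 'g pword set \<Rightarrow> ('g pword set) monoid" where
  "presented_group S R =
     \<lparr> carrier = pclass S R ` pwords S,
       monoid.mult = (\<lambda>A B. pclass S R ((SOME a. a \<in> A) @ (SOME b. b \<in> B))),
       monoid.one = pclass S R [] \<rparr>"

definition FB_gens :: "nat \<Rightarrow> nat set" where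
  "FB_gens n = {1..<n}"

definition FB_rels :: "nat \<Rightarrow> nat pword set" where
  "FB_rels n =
     {[(i, False), (i, False)] | i. i \<in> FB_gens n} \<union>
     {[(i, False), (j, False), (i, True), (j, True)] | i j.
        i \<in> FB_gens n \<and> j \<in> FB_gens n \<and> (i \<ge> j + 2 \<or> j \<ge> i + 2)}"

definition FB :: "nat \<Rightarrow> (nat pword set) monoid" where
  "FB n = presented_group (FB_gens n) (FB_rels n)"

definition adj_transp :: "nat \<Rightarrow> nat \<Rightarrow> nat" where
  "adj_transp i = (\<lambda>x. if x = i then Suc i else if x = Suc i then i else x)"

definition perm_of_word :: "nat pword \<Rightarrow> (nat \<Rightarrow> nat)" where
  "perm_of_word w = foldr (\<lambda>x f. adj_transp (fst x) \<circ> f) w id"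

text \<open>Pure flat braid group: kernel of FB_n \<rightarrow> Sym(n) (well defined on classes).\<close>
definition PFB :: "nat \<Rightarrow> (nat pword set) monoid" where
  "PFB n = (FB n) \<lparr> carrier :=
     {A \<in> carrier (FB n). perm_of_word (SOME w. w \<in> A) = id} \<rparr>"

definition RAAG_rels :: "'v set \<Rightarrow> ('v \<Rightarrow> 'v \<Rightarrow> bool) \<Rightarrow> 'v pword set" where
  "RAAG_rels V E = {[(u, False), (v, False), (u, True), (v, True)] | u v.
                      u \<in> V \<and> v \<in> V \<and> E u v}"

definition RAAG :: "'v set \<Rightarrow> ('v \<Rightarrow> 'v \<Rightarrow> bool) \<Rightarrow> ('v pword set) monoid" where
  "RAAG V E = presented_group V (RAAG_rels V E)"

end

theory Submission
  imports Defs "HOL-Library.Sublist"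
begin

text \<open>
  The group \<open>FB\<^sub>n\<close> is the amalgam of its parabolic subgroups avoiding \<open>\<sigma>\<^sub>3\<close>
  and avoiding \<open>\<sigma>\<^sub>4\<close>. The quotient of the Bass--Serre tree by \<open>PFB\<^sub>n\<close> is a finite graph that is not a tree, which
  yields a homomorphism \<open>\<psi>\<close> from \<open>PFB\<^sub>n\<close> to the integers that vanishes on all conjugates of the
  two factors, but not on \<open>(\<sigma>\<^sub>3\<sigma>\<^sub>4)\<^sup>3\<close>. Every element commuting with a conjugate of \<open>x = (\<sigma>\<^sub>1\<sigma>\<^sub>2)\<^sup>k\<close> or of
  \<open>y = (\<sigma>\<^sub>5\<sigma>\<^sub>6)\<^sup>k\<close> lies in a conjugate of a factor and so is killed by \<open>\<psi>\<close>, and any two conjugates of \<open>x\<close>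
  are linked by a chain of conjugates of \<open>x\<close> and \<open>y\<close> in which neighbours commute.

  Now let \<open>A(\<Gamma>)\<close> have finite index in \<open>PFB\<^sub>n\<close>. Some vertex \<open>v\<close> of \<open>\<Gamma>\<close> has \<open>\<psi>(v) \<noteq> 0\<close>. Consider the tree of the
  splitting of \<open>A(\<Gamma>)\<close> as an HNN extension of \<open>A(\<Gamma> - v)\<close> with stable letter \<open>v\<close>. Its edge stabilizers are centralized by
  conjugates of \<open>v\<close>, so they contain no conjugate of \<open>x\<close> or \<open>y\<close>. If \<open>x\<close> had an axis, some
  \<open>x\<^sup>a y\<^sup>b\<close> with \<open>b \<noteq> 0\<close> would fix it, but the centralizer of this element is killed by \<open>\<psi>\<close> as well. Hence \<open>x\<close> fixes a
  vertex, which is unique. Commuting elements of the chains share their fixed vertex, so all conjugates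
  of \<open>x\<close> fix the same vertex. Then \<open>v\<close> fixes it too, which is impossible as \<open>v\<close> acts without fixed vertices.
\<close>

no_notation subset_mset (infix "<#" 50)

section \<open>Commutation, conjugation and powers in groups\<close>

context group
begin

lemma commute_mult:
  assumes "x \<otimes> a = a \<otimes> x" "x \<otimes> b = b \<otimes> x"
    and "x \<in> carrier G" "a \<in> carrier G" "b \<in> carrier G"
  shows "x \<otimes> (a \<otimes> b) = a \<otimes> b \<otimes> x"
proof -
  have "x \<otimes> (a \<otimes> b) = a \<otimes> x \<otimes> b"
    using assms(1,3-) by (simp flip: m_assoc)
  also have "\<dots> = a \<otimes> b \<otimes> x" using assms(2-) by (simp add: m_assoc)
  finally show ?thesis .
qed

lemma commute_inv:
  assumes "x \<otimes> a = a \<otimes> x" "x \<in> carrier G" "a \<in> carrier G"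
  shows "x \<otimes> inv a = inv a \<otimes> x"
proof -
  have "a \<otimes> (x \<otimes> inv a) = x"
    using assms by (simp add: inv_solve_right' flip: m_assoc)
  then show ?thesis using assms inv_solve_left[of "x \<otimes> inv a" a x] by simp
qed

lemma conj_mult:
  assumes "h \<in> carrier G" "a \<in> carrier G" "b \<in> carrier G"
  shows "(inv h \<otimes> a \<otimes> h) \<otimes> (inv h \<otimes> b \<otimes> h) = inv h \<otimes> (a \<otimes> b) \<otimes> h"
proof -
  have "h \<otimes> (inv h \<otimes> (b \<otimes> h)) = b \<otimes> h"
    using assms by (simp flip: m_assoc)
  then show ?thesis using assms by (simp add: m_assoc)
qed

lemma conj_pow:
  assumes "h \<in> carrier G" "a \<in> carrier G"
  shows "(inv h \<otimes> a \<otimes> h) [^] (n::nat) = inv h \<otimes> (a [^] n) \<otimes> h"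
  using assms by (induction n) (auto simp: conj_mult)

lemma commutator_eq_one_iff:
  assumes "x \<in> carrier G" "y \<in> carrier G"
  shows "x \<otimes> y \<otimes> inv x \<otimes> inv y = \<one> \<longleftrightarrow> x \<otimes> y = y \<otimes> x"
proof -
  have "x \<otimes> y \<otimes> inv x \<otimes> inv y = \<one> \<longleftrightarrow> x \<otimes> y \<otimes> inv x = y"
    using assms inv_solve_right'[of \<one> "x \<otimes> y \<otimes> inv x" y] by auto
  also have "\<dots> \<longleftrightarrow> x \<otimes> y = y \<otimes> x"
    using assms inv_solve_right'[of y "x \<otimes> y" x] by auto
  finally show ?thesis .
qed

text \<open>By pigeonhole two of the cosets \<open>H #> g [^] i\<close> coincide, so some positive
  power of \<open>g\<close> with exponent at most the index lies in \<open>H\<close>. That exponent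
  divides the factorial of the index, which therefore serves all \<open>g\<close> at once.\<close>

lemma finite_index_power:
  assumes H: "subgroup H G" and fin: "finite (rcosets H)"
  shows "\<exists>N>0. \<forall>g \<in> carrier G. g [^] (N::nat) \<in> H"
proof (intro exI[of _ "fact (card (rcosets H))"] conjI ballI)
  fix g assume g: "g \<in> carrier G"
  let ?M = "card (rcosets H)"
  have sub: "(\<lambda>i. H #> g [^] i) ` {..?M} \<subseteq> rcosets H"
    using g H by (auto intro!: rcosetsI subgroup.subset)
  have "\<not> inj_on (\<lambda>i. H #> g [^] i) {..?M}"
    using card_inj_on_le[OF _ sub fin] by auto
  then obtain i j where ij: "i < j" "j \<le> ?M" "H #> g [^] i = H #> g [^] j"
    unfolding inj_on_def by (metis atMost_iff linorder_neqE_nat)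
  have "g [^] j \<in> H #> g [^] i"
    using rcos_self[OF _ H] g ij(3) by simp
  then obtain h where h: "h \<in> H" "g [^] j = h \<otimes> g [^] i"
    unfolding r_coset_def by auto
  have "g [^] (j - i) \<otimes> g [^] i = g [^] j"
    using g ij(1) by (simp add: nat_pow_mult)
  then have "g [^] (j - i) = h"
    using h g subgroup.mem_carrier[OF H h(1)] by (metis nat_pow_closed r_cancel)
  moreover have "j - i dvd fact ?M" using ij by (intro dvd_fact) auto
  then obtain q where "fact ?M = (j - i) * q" by (rule dvdE)
  ultimately have "g [^] (fact ?M :: nat) = h [^] q"
    using nat_pow_pow[OF g, of "j - i" q] by simp
  moreover have "h [^] q \<in> H" for q :: nat
    using h(1) H by (induction q) (auto intro: subgroup.one_closed subgroup.m_closed)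
  ultimately show "g [^] (fact ?M :: nat) \<in> H" by simp
qed simp

end

section \<open>Presented groups\<close>

lemma Nil_in_pwords [simp]: "[] \<in> pwords S"
  by (simp add: pwords_def)

lemma Cons_in_pwords [simp]: "l # w \<in> pwords S \<longleftrightarrow> fst l \<in> S \<and> w \<in> pwords S"
  by (auto simp: pwords_def)

lemma append_in_pwords [simp]: "u @ v \<in> pwords S \<longleftrightarrow> u \<in> pwords S \<and> v \<in> pwords S"
  by (auto simp: pwords_def)

lemma pwords_mono: "w \<in> pwords A \<Longrightarrow> A \<subseteq> S \<Longrightarrow> w \<in> pwords S"
  by (auto simp: pwords_def)

lemma pres_eq_in_pwords:
  assumes "pres_eq S R v w"
  shows "v \<in> pwords S" "w \<in> pwords S"
  using assms by (induction, auto)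

lemma pres_eq_context:
  assumes "pres_eq S R v w" "a \<in> pwords S" "b \<in> pwords S"
  shows "pres_eq S R (a @ v @ b) (a @ w @ b)"
  using assms
proof (induction rule: pres_eq.induct)
  case (pe_cancel u v g d)
  then show ?case using pres_eq.pe_cancel[of "a @ u" S "v @ b" g R d] by simp
next
  case (pe_rel u v r)
  then show ?case using pres_eq.pe_rel[of "a @ u" S "v @ b" r R] by simp
qed (auto intro: pres_eq.intros)

lemma pres_eq_append:
  assumes "pres_eq S R u u'" "pres_eq S R v v'"
  shows "pres_eq S R (u @ v) (u' @ v')"
  using pres_eq_context[OF assms(1), of "[]" v] pres_eq_context[OF assms(2), of u' "[]"]
    pres_eq_in_pwords[OF assms(1)] pres_eq_in_pwords[OF assms(2)]
  by (auto intro: pe_trans)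

definition word_inv :: "'g pword \<Rightarrow> 'g pword" where
  "word_inv w = rev (map (\<lambda>l. (fst l, \<not> snd l)) w)"

lemma word_inv_in_pwords [simp]: "word_inv w \<in> pwords S \<longleftrightarrow> w \<in> pwords S"
  by (auto simp: pwords_def word_inv_def)

lemma word_inv_word_inv [simp]: "word_inv (word_inv w) = w"
  by (simp add: word_inv_def rev_map comp_def)

lemma pres_eq_word_inv_right: "w \<in> pwords S \<Longrightarrow> pres_eq S R (w @ word_inv w) []"
proof (induction w)
  case Nil
  then show ?case by (simp add: word_inv_def pe_refl)
next
  case (Cons l w)
  have "pres_eq S R ([l] @ (w @ word_inv w) @ [(fst l, \<not> snd l)]) ([l] @ [] @ [(fst l, \<not> snd l)])"
    using Cons by (intro pres_eq_context) auto
  moreover have "pres_eq S R ([] @ [(fst l, snd l), (fst l, \<not> snd l)] @ []) ([] @ [])"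
    using Cons by (intro pe_cancel) auto
  ultimately show ?case by (auto simp: word_inv_def intro: pe_trans)
qed

lemma pres_eq_word_inv_left: "w \<in> pwords S \<Longrightarrow> pres_eq S R (word_inv w @ w) []"
  using pres_eq_word_inv_right[of "word_inv w" S R] by simp

lemma pclass_eq_iff:
  assumes "v \<in> pwords S"
  shows "pclass S R v = pclass S R w \<longleftrightarrow> pres_eq S R v w"
  using assms pe_refl[OF assms, of R] unfolding pclass_def
  by (auto intro: pe_trans pe_sym)

lemma pres_eq_some_in_pclass:
  "w \<in> pwords S \<Longrightarrow> pres_eq S R w (SOME v. v \<in> pclass S R w)"
  using someI[of "\<lambda>v. v \<in> pclass S R w" w] by (simp add: pclass_def pe_refl)

lemma carrier_presented_group: "carrier (presented_group S R) = pclass S R ` pwords S"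
  by (simp add: presented_group_def)

lemma one_presented_group: "\<one>\<^bsub>presented_group S R\<^esub> = pclass S R []"
  by (simp add: presented_group_def)

lemma mult_presented_group:
  assumes "u \<in> pwords S" "v \<in> pwords S"
  shows "pclass S R u \<otimes>\<^bsub>presented_group S R\<^esub> pclass S R v = pclass S R (u @ v)"
proof -
  have "pres_eq S R (u @ v) ((SOME a. a \<in> pclass S R u) @ (SOME b. b \<in> pclass S R v))"
    using assms by (intro pres_eq_append pres_eq_some_in_pclass)
  then have "pclass S R (u @ v) = pclass S R ((SOME a. a \<in> pclass S R u) @ (SOME b. b \<in> pclass S R v))"
    using assms by (subst pclass_eq_iff) auto
  then show ?thesis by (simp add: presented_group_def)
qed

lemma pclass_in_carrier [simp]: "w \<in> pwords S \<Longrightarrow> pclass S R w \<in> carrier (presented_group S R)"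
  by (simp add: carrier_presented_group)

lemma group_presented_group: "group (presented_group S R)"
proof (rule groupI)
  fix x assume "x \<in> carrier (presented_group S R)"
  then obtain w where w: "w \<in> pwords S" "x = pclass S R w"
    by (auto simp: carrier_presented_group)
  then have "pclass S R (word_inv w) \<otimes>\<^bsub>presented_group S R\<^esub> x = \<one>\<^bsub>presented_group S R\<^esub>"
    by (simp add: mult_presented_group one_presented_group pclass_eq_iff pres_eq_word_inv_left)
  then show "\<exists>y\<in>carrier (presented_group S R). y \<otimes>\<^bsub>presented_group S R\<^esub> x = \<one>\<^bsub>presented_group S R\<^esub>"
    using w by (intro bexI[of _ "pclass S R (word_inv w)"]) auto
qed (auto simp: carrier_presented_group one_presented_group mult_presented_group)

lemma inv_presented_group:
  assumes "w \<in> pwords S"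
  shows "inv\<^bsub>presented_group S R\<^esub> (pclass S R w) = pclass S R (word_inv w)"
  using assms pres_eq_word_inv_left[of w S R]
  by (intro group.inv_equality[OF group_presented_group])
    (auto simp: mult_presented_group one_presented_group pclass_eq_iff)

lemma subgroup_pclass_pwords:
  assumes "A \<subseteq> S"
  shows "subgroup (pclass S R ` pwords A) (presented_group S R)"
proof -
  have "w \<in> pwords S" if "w \<in> pwords A" for w
    using that assms pwords_mono by blast
  moreover have "pclass S R ` pwords A \<noteq> {}"
    using Nil_in_pwords by blast
  ultimately show ?thesis
    by (intro group.subgroupI[OF group_presented_group])
      (auto simp: mult_presented_group inv_presented_group)
qed

text \<open>A letterwise action descends to the presented group once cancellation and relators are
  checked; the actions below are made well defined this way. The set \<open>U\<close> allows for
  pushing letters, which is invertible on reduced words only.\<close>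

lemma foldr_pres_eq:
  assumes closed: "\<And>l x. fst l \<in> S \<Longrightarrow> x \<in> U \<Longrightarrow> f l x \<in> U"
    and cancel: "\<And>g b x. g \<in> S \<Longrightarrow> x \<in> U \<Longrightarrow> f (g, b) (f (g, \<not> b) x) = x"
    and rel: "\<And>r x. r \<in> R \<Longrightarrow> r \<in> pwords S \<Longrightarrow> x \<in> U \<Longrightarrow> foldr f r x = x"
    and eq: "pres_eq S R v w" and "x \<in> U"
  shows "foldr f v x = foldr f w x"
proof -
  have cl: "foldr f w x \<in> U" if "w \<in> pwords S" "x \<in> U" for w x
    using that by (induction w) (auto intro: closed)
  from eq show ?thesis using \<open>x \<in> U\<close>
    by (induction arbitrary: x rule: pres_eq.induct) (auto simp: cancel rel cl)
qed

lemma foldr_some_pclass: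
  assumes "\<And>v. pres_eq S R w v \<Longrightarrow> foldr f w x = foldr f v x" "w \<in> pwords S"
  shows "foldr f (SOME v. v \<in> pclass S R w) x = foldr f w x"
  using assms pres_eq_some_in_pclass by metis

text \<open>Centralizers are subgroups, so commutation passes from generators to words, first in one
  argument and then, by symmetry, in the other.\<close>

lemma pclass_words_commute:
  assumes comm: "\<And>a b. a \<in> A \<Longrightarrow> b \<in> B \<Longrightarrow>
      pclass S R [(a, False)] \<otimes>\<^bsub>presented_group S R\<^esub> pclass S R [(b, False)]
      = pclass S R [(b, False)] \<otimes>\<^bsub>presented_group S R\<^esub> pclass S R [(a, False)]"
    and "A \<subseteq> S" "B \<subseteq> S" "u \<in> pwords A" "v \<in> pwords B"
  shows "pclass S R u \<otimes>\<^bsub>presented_group S R\<^esub> pclass S R v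
    = pclass S R v \<otimes>\<^bsub>presented_group S R\<^esub> pclass S R u"
proof -
  interpret group "presented_group S R" by (rule group_presented_group)
  let ?c = "pclass S R"
  define C where "C x y \<longleftrightarrow> x \<otimes>\<^bsub>presented_group S R\<^esub> y = y \<otimes>\<^bsub>presented_group S R\<^esub> x" for x y
  have inv: "C (inv\<^bsub>presented_group S R\<^esub> x) y"
    if "C x y" "x \<in> carrier (presented_group S R)" "y \<in> carrier (presented_group S R)" for x y
    using that commute_inv[of y x] by (simp add: C_def)
  have mul: "C (x \<otimes>\<^bsub>presented_group S R\<^esub> z) y"
    if "C x y" "C z y" "x \<in> carrier (presented_group S R)" "y \<in> carrier (presented_group S R)"
      "z \<in> carrier (presented_group S R)" for x y z
    using that commute_mult[of y x z] by (simp add: C_def)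
  have sym: "C x y \<Longrightarrow> C y x" for x y by (simp add: C_def)
  have gen: "\<forall>w \<in> pwords D. C (?c w) y"
    if "\<forall>d \<in> D. C (?c [(d, False)]) y" "D \<subseteq> S" "y \<in> carrier (presented_group S R)" for D y
  proof
    fix w assume "w \<in> pwords D"
    then show "C (?c w) y"
    proof (induction w)
      case Nil
      then show ?case using that by (simp add: C_def flip: one_presented_group)
    next
      case (Cons l w)
      have l: "C (?c [(fst l, False)]) y" "fst l \<in> S"
        using Cons.prems that(1,2) by auto
      have "C (?c [l]) y"
      proof (cases "snd l")
        case True
        then have "word_inv [(fst l, False)] = [l]" by (simp add: word_inv_def prod_eq_iff)
        then have "?c [l] = inv\<^bsub>presented_group S R\<^esub> ?c [(fst l, False)]"
          using l(2) inv_presented_group[of "[(fst l, False)]" S R] by simp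
        then show ?thesis
          using inv[OF l(1)] l(2) that(3) by simp
      next
        case False
        then have "[(fst l, False)] = [l]" by (simp add: prod_eq_iff)
        then show ?thesis using l(1) by simp
      qed
      moreover have "w \<in> pwords S" "C (?c w) y" using Cons that(2) pwords_mono by auto
      ultimately have "C (?c [l] \<otimes>\<^bsub>presented_group S R\<^esub> ?c w) y"
        using l(2) that(3) by (intro mul) auto
      then show ?case using \<open>w \<in> pwords S\<close> l(2) by (simp add: mult_presented_group)
    qed
  qed
  have uS: "u \<in> pwords S" "v \<in> pwords S" using assms pwords_mono by blast+
  have "C (?c u) (?c [(b, False)])" if b: "b \<in> B" for b
  proof -
    have "\<forall>a\<in>A. C (?c [(a, False)]) (?c [(b, False)])"
      using comm[OF _ b] unfolding C_def by blast
    moreover have "?c [(b, False)] \<in> carrier (presented_group S R)"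
      using b assms(3) by (intro pclass_in_carrier) auto
    ultimately show ?thesis using gen assms(2,4) by blast
  qed
  then have "\<forall>b\<in>B. C (?c [(b, False)]) (?c u)" using sym by blast
  moreover have "?c u \<in> carrier (presented_group S R)" using uS by simp
  ultimately have "C (?c v) (?c u)" using gen assms(3,5) by blast
  then show ?thesis by (simp add: C_def)
qed

section \<open>Reduced words\<close>

type_synonym 'c letter = "'c \<times> bool"

text \<open>This is the inverse letter: with \<open>iv\<close> each letter is its own inverse, as in
  a free product of groups of order two; otherwise the sign is reversed, as in a free group.\<close>

definition flip :: "bool \<Rightarrow> 'c letter \<Rightarrow> 'c letter" where
  "flip iv l = (fst l, if iv then snd l else \<not> snd l)"

definition reduced :: "bool \<Rightarrow> 'c letter list \<Rightarrow> bool" where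
  "reduced iv L = successively (\<lambda>k l. l \<noteq> flip iv k) L"

definition push :: "bool \<Rightarrow> 'c letter \<Rightarrow> 'c letter list \<Rightarrow> 'c letter list" where
  "push iv l L = (if L \<noteq> [] \<and> hd L = flip iv l then tl L else l # L)"

lemma flip_flip [simp]: "flip iv (flip iv l) = l"
  by (simp add: flip_def)

lemma fst_flip [simp]: "fst (flip iv l) = fst l"
  by (simp add: flip_def)

lemma reduced_Nil [simp]: "reduced iv []"
  by (simp add: reduced_def)

lemma reduced_Cons:
  "reduced iv (l # L) \<longleftrightarrow> reduced iv L \<and> (L \<noteq> [] \<longrightarrow> hd L \<noteq> flip iv l)"
  by (cases L) (auto simp: reduced_def)

lemma reduced_append:
  "reduced iv (L @ M) \<longleftrightarrow> reduced iv L \<and> reduced iv M \<and>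
    (L \<noteq> [] \<and> M \<noteq> [] \<longrightarrow> hd M \<noteq> flip iv (last L))"
  by (auto simp: reduced_def successively_append_iff)

lemma reduced_push: "reduced iv L \<Longrightarrow> reduced iv (push iv l L)"
  by (cases L) (auto simp: push_def reduced_Cons)

lemma push_flip_push: "reduced iv L \<Longrightarrow> push iv (flip iv l) (push iv l L) = L"
  by (cases L) (auto simp: push_def reduced_Cons)

lemma push_push_flip: "reduced iv L \<Longrightarrow> push iv l (push iv (flip iv l) L) = L"
  using push_flip_push[of iv L "flip iv l"] by simp

lemma foldr_push_eq_append: "reduced iv (L @ M) \<Longrightarrow> foldr (push iv) L M = L @ M"
  by (induction L) (auto simp: push_def reduced_Cons)

text \<open>Each pushed letter cancels at most one letter at the front, so \<open>L\<close> never
  reaches beyond \<open>A\<close>, and \<open>A'\<close> depends on \<open>L\<close> and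
  \<open>A\<close> alone.\<close>

lemma foldr_push_long:
  "length L \<le> length A \<Longrightarrow> \<exists>A'. \<forall>M. foldr (push iv) L (A @ M) = A' @ M"
proof (induction L arbitrary: A rule: rev_induct)
  case Nil
  then show ?case by auto
next
  case (snoc a L)
  then obtain a1 A1 where A: "A = a1 # A1" by (cases A) auto
  show ?case
  proof (cases "a1 = flip iv a")
    case True
    then show ?thesis using snoc A by (simp add: push_def)
  next
    case False
    obtain A' where "\<forall>M. foldr (push iv) L ((a # A) @ M) = A' @ M"
      using snoc.IH[of "a # A"] snoc.prems by auto
    moreover have "push iv a (A @ M) = (a # A) @ M" for M
      using False A by (simp add: push_def)
    ultimately show ?thesis by simp
  qed
qed

text \<open>Dually, \<open>M\<close> can cancel at most \<open>length M\<close> letters at the end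
  of \<open>L\<close>, and the rest of \<open>L\<close> survives.\<close>

lemma prefix_foldr_push:
  assumes "reduced iv L" "reduced iv M"
  shows "prefix (take (length L - length M) L) (foldr (push iv) L M)"
  using assms
proof (induction L arbitrary: M rule: rev_induct)
  case Nil
  then show ?case by simp
next
  case (snoc a L)
  show ?case
  proof (cases "M \<noteq> [] \<and> hd M = flip iv a")
    case True
    then obtain M' where M: "M = flip iv a # M'" by (cases M) auto
    then show ?thesis
      using snoc.IH[of M'] snoc.prems by (auto simp: push_def reduced_append reduced_Cons)
  next
    case False
    then have "reduced iv ((L @ [a]) @ M)"
      using snoc.prems by (auto simp: reduced_append reduced_Cons)
    then show ?thesis
      using foldr_push_eq_append[of iv "L @ [a]" M] by (metis append_take_drop_id append.assoc prefixI)
  qed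
qed

section \<open>A tree for a group split along a generator\<close>

text \<open>
  The reduced words in letters \<open>(h K, d)\<close>, \<open>h \<in> B\<close>, are the vertices of a tree whose edges join a
  word to its one-letter extensions. The element \<open>c\<close> pushes its own letter, \<open>B\<close> permutes the letters.
  If \<open>c\<close> has infinite order, this is the Bass--Serre tree of the HNN extension of \<open>B\<close> whose stable letter \<open>c\<close>
  centralizes \<open>K\<close>; if \<open>c\<close> is an involution, which is flagged by \<open>iv\<close>, it is that of the amalgam
  of \<open>B\<close> and \<open>K \<times> \<langle>c\<rangle>\<close> over \<open>K\<close>, with the vertices of degree two suppressed.
\<close>

locale split_data = group P for P (structure) +
  fixes B K :: "'a set" and c :: 'a and iv :: bool
  assumes B: "subgroup B P" and K: "subgroup K P" and K_B: "K \<subseteq> B"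
    and c [simp]: "c \<in> carrier P"
    and K_c: "k \<in> K \<Longrightarrow> k \<otimes> c = c \<otimes> k"
    and iv_c: "iv \<Longrightarrow> c \<otimes> c = \<one>"
    and generates: "carrier P \<subseteq> generate P (insert c B)"
begin

definition \<Omega> :: "'a set letter list set" where
  "\<Omega> = {L. reduced iv L \<and> fst ` set L \<subseteq> (\<lambda>h. h <# K) ` B}"

definition move :: "'a \<Rightarrow> 'a set letter list \<Rightarrow> 'a set letter list" where
  "move b L = map (\<lambda>l. (b <# fst l, snd l)) L"

lemma B_carrier [simp]: "b \<in> B \<Longrightarrow> b \<in> carrier P"
  using B subgroup.mem_carrier by metis

lemma K_carrier [simp]: "k \<in> K \<Longrightarrow> k \<in> carrier P"
  using K_B by auto

lemma K_sub [simp]: "K \<subseteq> carrier P"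
  by auto

lemma one_B [simp]: "\<one> \<in> B"
  using B subgroup.one_closed by metis

lemma mult_B [simp]: "\<lbrakk>a \<in> B; b \<in> B\<rbrakk> \<Longrightarrow> a \<otimes> b \<in> B"
  using B subgroup.m_closed by metis

lemma inv_B [simp]: "b \<in> B \<Longrightarrow> inv b \<in> B"
  using B subgroup.m_inv_closed by metis

lemma inv_mult_cancel: "\<lbrakk>a \<in> carrier P; x \<in> carrier P\<rbrakk> \<Longrightarrow> inv a \<otimes> (a \<otimes> x) = x"
  by (simp flip: m_assoc)

lemma one_coset [simp]: "\<one> <# K = K"
  by (simp add: lcos_mult_one)

lemma coset_mult [simp]: "\<lbrakk>a \<in> carrier P; b \<in> carrier P\<rbrakk> \<Longrightarrow> a <# (b <# K) = (a \<otimes> b) <# K"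
  by (simp add: lcos_m_assoc)

lemma coset_eq_K_iff:
  assumes "h \<in> carrier P"
  shows "h <# K = K \<longleftrightarrow> h \<in> K"
proof
  assume "h <# K = K"
  then show "h \<in> K"
    using assms subgroup.one_closed[OF K] unfolding l_coset_def by force
next
  assume "h \<in> K"
  then show "h <# K = K"
    by (rule coset_join3[OF assms K])
qed

lemma coset_eq_iff:
  assumes "a \<in> carrier P" "b \<in> carrier P"
  shows "a <# K = b <# K \<longleftrightarrow> inv b \<otimes> a \<in> K"
proof -
  have "a <# K = b <# K \<longleftrightarrow> inv b <# (a <# K) = K"
  proof
    assume "inv b <# (a <# K) = K"
    then have "b <# (inv b <# (a <# K)) = b <# K" by simp
    then show "a <# K = b <# K" using assms by (simp flip: m_assoc)
  qed (use assms in simp)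
  then show ?thesis using assms by (simp add: coset_eq_K_iff)
qed

lemma Nil_\<Omega> [simp]: "[] \<in> \<Omega>"
  by (simp add: \<Omega>_def)

lemma Cons_\<Omega>: "l # L \<in> \<Omega> \<longleftrightarrow> L \<in> \<Omega> \<and> fst l \<in> (\<lambda>h. h <# K) ` B \<and> (L \<noteq> [] \<longrightarrow> hd L \<noteq> flip iv l)"
  by (auto simp: \<Omega>_def reduced_Cons)

lemma \<Omega>_reduced: "L \<in> \<Omega> \<Longrightarrow> reduced iv L"
  by (simp add: \<Omega>_def)

lemma push_\<Omega>: "\<lbrakk>L \<in> \<Omega>; fst l \<in> (\<lambda>h. h <# K) ` B\<rbrakk> \<Longrightarrow> push iv l L \<in> \<Omega>"
  unfolding \<Omega>_def using reduced_push[of iv L l] by (cases L) (auto simp: push_def)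

lemma move_Cons [simp]: "move b (l # L) = (b <# fst l, snd l) # move b L"
  by (simp add: move_def)

lemma move_Nil [simp]: "move b [] = []" "move b L = [] \<longleftrightarrow> L = []"
  by (simp_all add: move_def)

lemma move_append [simp]: "move b (L @ M) = move b L @ move b M"
  by (simp add: move_def)

lemma length_move [simp]: "length (move b L) = length L"
  by (simp add: move_def)

lemma move_letter_eq_iff:
  assumes "b \<in> B" "C \<in> (\<lambda>h. h <# K) ` B" "C' \<in> (\<lambda>h. h <# K) ` B"
  shows "b <# C = b <# C' \<longleftrightarrow> C = C'"
proof
  assume eq: "b <# C = b <# C'"
  obtain h h' where h: "h \<in> B" "C = h <# K" "h' \<in> B" "C' = h' <# K" using assms by auto
  from eq have "inv b <# (b <# C) = inv b <# (b <# C')" by simp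
  then show "C = C'" using h assms(1) by (simp flip: m_assoc)
qed simp

lemma move_\<Omega>: "\<lbrakk>b \<in> B; L \<in> \<Omega>\<rbrakk> \<Longrightarrow> move b L \<in> \<Omega>"
proof (induction L)
  case (Cons l L)
  then obtain h where h: "h \<in> B" "fst l = h <# K" by (auto simp: Cons_\<Omega>)
  have "hd (move b L) \<noteq> flip iv (b <# fst l, snd l)" if ne: "L \<noteq> []"
  proof -
    obtain l' L' where L: "L = l' # L'" using ne by (cases L) auto
    then have "l' \<noteq> flip iv l" "fst l' \<in> (\<lambda>h. h <# K) ` B" "fst l \<in> (\<lambda>h. h <# K) ` B"
      using Cons.prems by (auto simp: Cons_\<Omega>)
    then show ?thesis
      using move_letter_eq_iff[of b "fst l'" "fst l"] Cons.prems(1)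
      by (auto simp: L flip_def prod_eq_iff)
  qed
  then show ?case using Cons h by (auto simp: Cons_\<Omega>)
qed simp

lemma move_push:
  assumes "b \<in> B" "L \<in> \<Omega>" "fst l \<in> (\<lambda>h. h <# K) ` B"
  shows "move b (push iv l L) = push iv (b <# fst l, snd l) (move b L)"
proof (cases L)
  case (Cons l' L')
  then have "fst l' \<in> (\<lambda>h. h <# K) ` B" using assms by (auto simp: Cons_\<Omega>)
  then show ?thesis
    using move_letter_eq_iff[of b "fst l'" "fst l"] assms
    by (auto simp: Cons push_def flip_def prod_eq_iff)
qed (simp add: push_def)

lemma move_move:
  assumes "a \<in> B" "b \<in> B" "L \<in> \<Omega>"
  shows "move a (move b L) = move (a \<otimes> b) L"
  using assms(3)
proof (induction L)
  case (Cons l L)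
  then obtain h where h: "h \<in> B" "fst l = h <# K" by (auto simp: Cons_\<Omega>)
  then show ?case using Cons assms by (simp add: Cons_\<Omega> m_assoc)
qed simp

lemma move_one: "L \<in> \<Omega> \<Longrightarrow> move \<one> L = L"
  by (induction L) (auto simp: Cons_\<Omega>)

lemma K_coset: "K \<in> (\<lambda>h. h <# K) ` B"
  by (rule image_eqI[of _ _ \<one>]) auto

lemma induct_generators [consumes 1, case_names B c inv_c mult]:
  assumes "g \<in> carrier P" "\<And>b. b \<in> B \<Longrightarrow> Q b" "Q c" "Q (inv c)"
    "\<And>g h. \<lbrakk>g \<in> carrier P; h \<in> carrier P; Q g; Q h\<rbrakk> \<Longrightarrow> Q (g \<otimes> h)"
  shows "Q g"
proof -
  have sub: "insert c B \<subseteq> carrier P" by auto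
  have "g \<in> generate P (insert c B)" using assms(1) generates by auto
  then show ?thesis
  proof (induction rule: generate.induct)
    case (inv h)
    then show ?case using assms by auto
  next
    case (eng g h)
    then show ?case using assms(5) generate_in_carrier[OF sub] by blast
  qed (use assms in auto)
qed

end

section \<open>The action on the tree and its stabilizers\<close>

text \<open>The action is a parameter here; it is constructed later from a presentation, whose
  relators guarantee that it is well defined.\<close>

locale split_group = split_data +
  fixes act :: "'a \<Rightarrow> 'a set letter list \<Rightarrow> 'a set letter list"
  assumes act_mult: "\<lbrakk>g \<in> carrier P; h \<in> carrier P; L \<in> \<Omega>\<rbrakk> \<Longrightarrow> act (g \<otimes> h) L = act g (act h L)"
    and act_B: "\<lbrakk>b \<in> B; L \<in> \<Omega>\<rbrakk> \<Longrightarrow> act b L = move b L"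
    and act_c: "L \<in> \<Omega> \<Longrightarrow> act c L = push iv (K, False) L"
    and act_inv_c: "L \<in> \<Omega> \<Longrightarrow> act (inv c) L = push iv (flip iv (K, False)) L"
begin

lemma act_\<Omega>: "\<lbrakk>g \<in> carrier P; L \<in> \<Omega>\<rbrakk> \<Longrightarrow> act g L \<in> \<Omega>"
proof (induction arbitrary: L rule: induct_generators)
  case (mult g h)
  then show ?case by (simp add: act_mult)
qed (auto simp: act_B act_c act_inv_c move_\<Omega> push_\<Omega> K_coset)

lemma act_one: "L \<in> \<Omega> \<Longrightarrow> act \<one> L = L"
  by (simp add: act_B move_one)

lemma act_inv_act: "\<lbrakk>g \<in> carrier P; L \<in> \<Omega>\<rbrakk> \<Longrightarrow> act (inv g) (act g L) = L"
  by (simp add: act_one flip: act_mult)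

lemma act_eq_iff:
  assumes "g \<in> carrier P" "L \<in> \<Omega>" "M \<in> \<Omega>"
  shows "act g L = act g M \<longleftrightarrow> L = M"
  using act_inv_act assms by metis

definition stable :: "bool \<Rightarrow> 'a" where
  "stable d = (if d then inv c else c)"

lemma stable_closed [simp]: "stable d \<in> carrier P"
  by (simp add: stable_def)

text \<open>The elements carrying the base point \<open>[]\<close> to \<open>L\<close> form the set \<open>coset_of L\<close>.\<close>

fun coset_of :: "'a set letter list \<Rightarrow> 'a set" where
  "coset_of [] = B"
| "coset_of (l # L) = {h \<otimes> stable (snd l) \<otimes> inv h \<otimes> g | h g. h \<in> B \<and> fst l = h <# K \<and> g \<in> coset_of L}"

lemma coset_of_carrier: "g \<in> coset_of L \<Longrightarrow> g \<in> carrier P"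
  by (induction L arbitrary: g) auto

lemma coset_of_move: "\<lbrakk>b \<in> B; g \<in> coset_of L\<rbrakk> \<Longrightarrow> b \<otimes> g \<in> coset_of (move b L)"
proof (induction L arbitrary: g)
  case (Cons l L)
  then obtain h g' where g: "g = h \<otimes> stable (snd l) \<otimes> inv h \<otimes> g'" "h \<in> B" "fst l = h <# K"
    "g' \<in> coset_of L" by auto
  have "b \<otimes> g = (b \<otimes> h) \<otimes> stable (snd l) \<otimes> inv (b \<otimes> h) \<otimes> (b \<otimes> g')"
    using g(1-3) Cons.prems(1) coset_of_carrier[OF g(4)]
    by (simp add: m_assoc inv_mult_group inv_mult_cancel)
  moreover have "b \<otimes> h \<in> B" "fst (b <# fst l, snd l) = (b \<otimes> h) <# K" "b \<otimes> g' \<in> coset_of (move b L)"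
    using Cons g by auto
  ultimately show ?case by fastforce
qed simp

lemma K_stable:
  assumes "k \<in> K"
  shows "k \<otimes> stable d \<otimes> inv k = stable d"
proof -
  have "k \<otimes> c \<otimes> inv k = c"
    using K_c assms by (simp add: inv_solve_right')
  moreover from this have "k \<otimes> inv c \<otimes> inv k = inv c"
    using assms inv_mult_group[of "k \<otimes> c" "inv k"] by (simp add: inv_mult_group m_assoc)
  ultimately show ?thesis by (simp add: stable_def)
qed

text \<open>If the new letter cancels, the first letter of \<open>L\<close> is represented by some
  \<open>h\<close> with \<open>h <# K = K\<close>. Then \<open>h\<close> lies in \<open>K\<close>,
  commutes with \<open>c\<close>, and the two stable letters cancel in the group as well.\<close>

lemma coset_of_push:
  assumes "g \<in> coset_of L"
  shows "stable d \<otimes> g \<in> coset_of (push iv (if d then flip iv (K, False) else (K, False)) L)"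
proof -
  define l where "l = (if d then flip iv (K, False) else (K, False))"
  have inv_c: "inv c = c" if iv
    using iv_c[OF that] by (simp add: inv_equality)
  have st: "stable (snd l) = stable d" "stable (snd (flip iv l)) = inv (stable d)"
    using inv_c by (auto simp: l_def flip_def stable_def)
  have fl: "fst l = K" by (auto simp: l_def)
  show ?thesis
  proof (cases "L \<noteq> [] \<and> hd L = flip iv l")
    case True
    then obtain L' where L: "L = flip iv l # L'" by (cases L) auto
    then obtain h g' where g: "g = h \<otimes> inv (stable d) \<otimes> inv h \<otimes> g'" "h \<in> B" "K = h <# K"
      "g' \<in> coset_of L'" using assms st fl by auto
    then have "h \<in> K" using coset_eq_K_iff[of h] by simp
    then have "h \<otimes> inv (stable d) \<otimes> inv h = inv (stable d)"
      using K_stable[of h d] K_stable[of h "\<not> d"] inv_c by (cases d) (auto simp: stable_def)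
    then have "stable d \<otimes> g = g'"
      using g coset_of_carrier[OF g(4)] by (simp flip: m_assoc)
    then show ?thesis using g L by (simp add: push_def flip: l_def)
  next
    case False
    have "stable d \<otimes> g = \<one> \<otimes> stable (snd l) \<otimes> inv \<one> \<otimes> g"
      using st coset_of_carrier[OF assms] by simp
    moreover have "fst l = \<one> <# K" using fl by simp
    ultimately have "stable d \<otimes> g \<in> coset_of (l # L)"
      using assms one_B unfolding coset_of.simps by blast
    then show ?thesis using False by (auto simp: push_def simp flip: l_def)
  qed
qed

text \<open>This equivariance replaces a normal form theorem: applied to the base point it shows
  that an element fixing \<open>[]\<close> lies in \<open>coset_of [] = B\<close>.\<close>

lemma mult_coset_of:
  "\<lbrakk>g \<in> carrier P; L \<in> \<Omega>; a \<in> coset_of L\<rbrakk> \<Longrightarrow> g \<otimes> a \<in> coset_of (act g L)"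
proof (induction arbitrary: L a rule: induct_generators)
  case (B b)
  then show ?case by (simp add: act_B coset_of_move)
next
  case c
  then show ?case using coset_of_push[of a L False] by (simp add: act_c stable_def)
next
  case inv_c
  then show ?case using coset_of_push[of a L True] by (simp add: act_inv_c stable_def)
next
  case (mult g h)
  then show ?case by (simp add: act_mult act_\<Omega> m_assoc coset_of_carrier)
qed

lemma in_coset_of_act: "g \<in> carrier P \<Longrightarrow> g \<in> coset_of (act g [])"
  using mult_coset_of[of g "[]" \<one>] by simp

lemma stabilizer_base: "\<lbrakk>g \<in> carrier P; act g [] = []\<rbrakk> \<Longrightarrow> g \<in> B"
  using in_coset_of_act by fastforce

lemma act_B_base: "b \<in> B \<Longrightarrow> act b [] = []"
  by (simp add: act_B)

text \<open>Elements of \<open>B\<close> act letter by letter, so \<open>y\<close> fixes the first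
  letter \<open>h <# K\<close> of \<open>L\<close>, that is, an edge at the base point, whose
  stabilizer is the conjugate of \<open>K\<close> by \<open>h\<close>.\<close>

lemma fixed_vertex_conj_K:
  assumes "y \<in> B" "L \<in> \<Omega>" "L \<noteq> []" "act y L = L"
  shows "\<exists>h \<in> carrier P. inv h \<otimes> y \<otimes> h \<in> K"
proof -
  obtain l L' where L: "L = l # L'" using assms(3) by (cases L) auto
  then obtain h where h: "h \<in> B" "fst l = h <# K" using assms(2) by (auto simp: Cons_\<Omega>)
  have "y <# fst l = fst l" using assms L by (auto simp: act_B prod_eq_iff)
  then have "(y \<otimes> h) <# K = h <# K" using h assms(1) by simp
  then have "inv h \<otimes> (y \<otimes> h) \<in> K" using h assms(1) by (subst (asm) coset_eq_iff) auto
  then show ?thesis using h assms(1) by (intro bexI[of _ h]) (auto simp: m_assoc)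
qed

text \<open>The element \<open>y\<close> fixes both \<open>[]\<close> and the different vertex
  \<open>act g []\<close>, hence an edge between them.\<close>

proposition conj_in_B:
  assumes "y \<in> B" "g \<in> carrier P" "inv g \<otimes> y \<otimes> g \<in> B" "g \<notin> B"
  shows "\<exists>h \<in> carrier P. inv h \<otimes> y \<otimes> h \<in> K"
proof -
  have "act (inv g \<otimes> y \<otimes> g) [] = []" using assms(3) by (rule act_B_base)
  then have "act (inv g) (act y (act g [])) = []"
    using assms by (simp add: act_mult act_\<Omega>)
  then have "act g (act (inv g) (act y (act g []))) = act g []" by simp
  then have "act y (act g []) = act g []"
    using assms act_inv_act[of "inv g" "act y (act g [])"] by (simp add: act_\<Omega>)
  moreover have "act g [] \<noteq> []" using stabilizer_base assms by blast
  moreover have "act g [] \<in> \<Omega>" using act_\<Omega> assms by simp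
  ultimately show ?thesis using fixed_vertex_conj_K assms(1) by blast
qed

section \<open>Axes and commuting elements when the stable letter has infinite order\<close>

text \<open>The conjugate of a stable letter by \<open>h\<close> acts by pushing the letter with
  coset \<open>h <# K\<close>. So an element acts as some \<open>b\<close> in \<open>B\<close>
  followed by left multiplication with the word to which it carries the base point.\<close>

lemma act_eq_foldr_push:
  assumes "\<not> iv" "g \<in> coset_of L" "L \<in> \<Omega>"
  shows "\<exists>b \<in> B. \<forall>M \<in> \<Omega>. act g M = foldr (push iv) L (move b M)"
  using assms(2,3)
proof (induction L arbitrary: g)
  case Nil
  then show ?case by (auto simp: act_B)
next
  case (Cons l L)
  then obtain h g' where g: "g = h \<otimes> stable (snd l) \<otimes> inv h \<otimes> g'" "h \<in> B" "fst l = h <# K"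
    "g' \<in> coset_of L" by auto
  obtain b where b: "b \<in> B" "\<forall>M \<in> \<Omega>. act g' M = foldr (push iv) L (move b M)"
    using Cons.IH[OF g(4)] Cons.prems by (auto simp: Cons_\<Omega>)
  have "act g M = push iv l (act g' M)" if M: "M \<in> \<Omega>" for M
  proof -
    define N where "N = act g' M"
    have N: "N \<in> \<Omega>" using M coset_of_carrier[OF g(4)] by (simp add: N_def act_\<Omega>)
    have "act g M = act h (act (stable (snd l)) (act (inv h) N))"
      using M g(1,2) coset_of_carrier[OF g(4)] N unfolding N_def by (simp add: act_mult act_\<Omega>)
    also have "\<dots> = act h (push iv (K, snd l) (move (inv h) N))"
      using assms(1) N g(2) move_\<Omega>[of "inv h" N]
      by (cases "snd l") (auto simp: act_B act_c act_inv_c stable_def flip_def)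
    also have "\<dots> = move h (push iv (K, snd l) (move (inv h) N))"
      using N g(2) by (intro act_B push_\<Omega> move_\<Omega>) (auto simp: K_coset)
    also have "\<dots> = push iv (h <# K, snd l) N"
      using N g(2) by (simp add: move_push move_\<Omega> K_coset move_move move_one)
    also have "(h <# K, snd l) = l" using g(3) by (simp add: prod_eq_iff)
    finally show ?thesis by (simp add: N_def)
  qed
  then show ?case using b by auto
qed

lemma act_eq_foldr_push':
  assumes "\<not> iv" "g \<in> carrier P"
  obtains b where "b \<in> B" "\<And>M. M \<in> \<Omega> \<Longrightarrow> act g M = foldr (push iv) (act g []) (move b M)"
  using act_eq_foldr_push[OF assms(1) in_coset_of_act[OF assms(2)] act_\<Omega>[OF assms(2) Nil_\<Omega>]] that
  by blast

text \<open>
  A commuting pair \<open>x, y\<close> such that \<open>x\<close> has no fixed vertex: \<open>x\<close> translates an axis, which is given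
  here by the words \<open>x\<^sup>j []\<close>. As \<open>y\<close> preserves the end of the axis, it translates far points of the
  axis by a fixed amount, and so some combination of powers of \<open>x\<close> and \<open>y\<close> fixes the axis.
\<close>

lemma commuting_axis:
  assumes iv: "\<not> iv" and x: "x \<in> carrier P" and y: "y \<in> carrier P" and xy: "x \<otimes> y = y \<otimes> x"
    and nonempty: "act x [] \<noteq> []"
    and minimal: "\<And>u. u \<in> carrier P \<Longrightarrow> length (act x []) \<le> length (act (inv u \<otimes> x \<otimes> u) [])"
  shows "\<exists>z \<in> carrier P. \<exists>(l::nat) (a::nat) (b::nat). l > 0 \<and> z \<otimes> x [^] a = y [^] l \<otimes> x [^] b \<and>
    (\<exists>h \<in> carrier P. inv h \<otimes> z \<otimes> h \<in> K)"
proof -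
  define n where "n = act x []"
  define l where "l = length n"
  have n_\<Omega>: "n \<in> \<Omega>" using x by (simp add: n_def act_\<Omega>)
  have l: "l > 0" using nonempty by (simp add: l_def n_def)
  obtain b where b: "b \<in> B" "\<And>M. M \<in> \<Omega> \<Longrightarrow> act x M = foldr (push iv) n (move b M)"
    using act_eq_foldr_push'[OF iv x] unfolding n_def by blast
  \<comment> \<open>If the end of \<open>n\<close> cancelled against the start of its translate,
    conjugating \<open>x\<close> by an element \<open>u\<close> that carries \<open>[]\<close> to
    the first letter \<open>[k]\<close> of \<open>n\<close> would shorten \<open>n\<close> by two
    letters, against \<open>minimal\<close>.\<close>
  have junction: "hd (move b n) \<noteq> flip iv (last n)"
  proof
    assume eq: "hd (move b n) = flip iv (last n)"
    obtain k N where n: "n = k # N" using nonempty by (cases n) (auto simp: n_def)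
    obtain h where h: "h \<in> B" "fst k = h <# K" using n_\<Omega> n by (auto simp: Cons_\<Omega>)
    define u where "u = h \<otimes> stable (snd k) \<otimes> inv h"
    have u: "u \<in> carrier P" using h by (simp add: u_def)
    have u_coset: "u \<in> coset_of [k]"
    proof -
      have "u = h \<otimes> stable (snd k) \<otimes> inv h \<otimes> \<one>" using h by (simp add: u_def)
      moreover have "\<one> \<in> coset_of []" by simp
      ultimately show ?thesis unfolding coset_of.simps(2) using h by blast
    qed
    have k_\<Omega>: "[k] \<in> \<Omega>" using h by (simp add: Cons_\<Omega>)
    \<comment> \<open>\<open>move\<close> keeps the sign of a letter while \<open>flip\<close>
      reverses it, so a single letter cannot cancel against its own translate.\<close>
    have N_ne: "N \<noteq> []"
    proof
      assume "N = []"
      then show False using eq n iv by (auto simp: flip_def prod_eq_iff)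
    qed
    obtain b' where b': "b' \<in> B" "\<And>M. M \<in> \<Omega> \<Longrightarrow> act u M = push iv k (move b' M)"
      using act_eq_foldr_push[OF iv u_coset k_\<Omega>] by auto
    have act_u: "act u [] = [k]" using b'(2)[of "[]"] by (simp add: push_def)
    have n': "n = butlast n @ [last n]" using n by simp
    have "act x [k] = foldr (push iv) (butlast n @ [last n]) (move b [k])"
      using b(2)[OF k_\<Omega>] by (simp flip: n')
    also have "\<dots> = foldr (push iv) (butlast n) (push iv (last n) (move b [k]))"
      by simp
    also have "push iv (last n) (move b [k]) = []"
      using eq n by (simp add: push_def)
    also have "foldr (push iv) (butlast n) [] = butlast n"
    proof -
      have "reduced iv (butlast n @ [last n])" using \<Omega>_reduced[OF n_\<Omega>] n' by simp
      then show ?thesis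
        using foldr_push_eq_append[of iv "butlast n" "[]"] unfolding reduced_append by simp
    qed
    finally have act_xu: "act x [k] = k # butlast N" using n N_ne by simp
    have bl: "butlast N \<in> \<Omega>" "k # butlast N \<in> \<Omega>"
      using act_\<Omega>[OF x k_\<Omega>] act_xu by (auto simp: Cons_\<Omega>)
    define M where "M = act (inv u) (k # butlast N)"
    have M: "M \<in> \<Omega>" using bl u by (simp add: M_def act_\<Omega>)
    have "push iv k (move b' M) = k # butlast N"
      using b'(2)[OF M] act_inv_act[of "inv u" "k # butlast N"] bl u by (simp add: M_def)
    then have "push iv (flip iv k) (push iv k (move b' M)) = butlast N"
      by (simp add: push_def)
    then have "move b' M = butlast N"
      using push_flip_push[of iv "move b' M" k] move_\<Omega>[OF b'(1) M] \<Omega>_reduced by simp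
    then have len: "length M = length (butlast N)" by (metis length_move)
    have "act (inv u \<otimes> x \<otimes> u) [] = M"
      using x u act_u act_xu k_\<Omega> by (simp add: act_mult act_\<Omega> M_def)
    then show False
      using minimal[OF u] len n by (simp add: n_def[symmetric])
  qed
  \<comment> \<open>The points \<open>p j\<close> lie on the axis of \<open>x\<close>. By
    \<open>junction\<close> no cancellation occurs, so they are nested prefixes of length
    \<open>j * l\<close>, which describe one end of the axis.\<close>
  define p where "p j = act (x [^] j) []" for j :: nat
  have p_\<Omega>: "p j \<in> \<Omega>" for j using x by (simp add: p_def act_\<Omega>)
  have p0: "p 0 = []" by (simp add: p_def act_one)
  have p_act: "p (Suc j) = act x (p j)" for j
    unfolding p_def nat_pow_Suc2[OF x] using x by (simp add: act_mult)
  have p_add: "p (i + j) = act (x [^] i) (p j)" for i j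
    unfolding p_def nat_pow_mult[OF x, symmetric] using x by (simp add: act_mult)
  have p_Suc: "p (Suc j) = n @ move b (p j)" for j
  proof (induction j)
    case 0
    then show ?case by (simp add: p0 p_act n_def)
  next
    case (Suc j)
    have "hd (move b (p (Suc j))) = hd (move b n)"
      using nonempty by (simp add: Suc n_def[symmetric])
    then have "reduced iv (n @ move b (p (Suc j)))"
      using \<Omega>_reduced[OF n_\<Omega>] \<Omega>_reduced[OF move_\<Omega>[OF b(1) p_\<Omega>[of "Suc j"]]] junction
      by (simp add: reduced_append)
    then show ?case
      using foldr_push_eq_append b(2)[OF p_\<Omega>] p_act[of "Suc j"] by simp
  qed
  have length_p: "length (p j) = j * l" for j
    by (induction j) (auto simp: p0 p_Suc l_def)
  have prefix_Suc: "prefix (p j) (p (Suc j))" for j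
  proof (induction j)
    case (Suc j)
    then obtain r where "p (Suc j) = p j @ r" by (auto elim: prefixE)
    then have "p (Suc (Suc j)) = p (Suc j) @ move b r"
      by (metis p_Suc append.assoc move_append)
    then show ?case by simp
  qed (simp add: p0)
  have prefix_p: "prefix (p i) (p j)" if "i \<le> j" for i j
    using that by (induction j rule: dec_induct) (auto intro: prefix_Suc prefix_order.trans)
  have commute_pow: "g \<otimes> x [^] j = x [^] j \<otimes> g" if "g \<in> carrier P" "x \<otimes> g = g \<otimes> x" for g and j :: nat
    using group_commutes_pow[OF that(2) x that(1), of j] by simp
  have act_p: "act g (p j) = act (x [^] j) (act g [])" if "g \<in> carrier P" "x \<otimes> g = g \<otimes> x" for g j
    using commute_pow[OF that, of j] that(1) x by (simp add: p_def flip: act_mult)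
  \<comment> \<open>High powers of \<open>x\<close> push any vertex towards this end:
    \<open>L\<close> can cancel only \<open>length L\<close> letters of \<open>p j\<close>.\<close>
  have far: "prefix (p i) (act (x [^] j) L)" if "L \<in> \<Omega>" "i + length L \<le> j" for i j L
  proof -
    obtain b' where b': "b' \<in> B"
      "\<And>M. M \<in> \<Omega> \<Longrightarrow> act (x [^] j) M = foldr (push iv) (p j) (move b' M)"
      using act_eq_foldr_push'[OF iv nat_pow_closed[OF x, of j]] unfolding p_def by blast
    have "i * l + length L \<le> (i + length L) * l" using l by (simp add: add_mult_distrib)
    also have "\<dots> \<le> j * l" using that(2) by simp
    finally have le: "length (p i) \<le> length (p j) - length L" by (simp add: length_p)
    have "i \<le> j" using that(2) by simp
    then have "prefix (p i) (take (length (p j) - length L) (p j))"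
      using prefix_p[of i j] le by (auto elim!: prefixE simp: length_p)
    also have "prefix \<dots> (act (x [^] j) L)"
      using prefix_foldr_push[of iv "p j" "move b' L"] \<Omega>_reduced[OF p_\<Omega>[of j]]
        \<Omega>_reduced[OF move_\<Omega>[OF b'(1) that(1)]] b'(2)[OF that(1)] by simp
    finally show ?thesis .
  qed
  \<comment> \<open>On words that begin with a long enough piece of the axis, \<open>g\<close>
    merely exchanges this prefix for a fixed word \<open>A'\<close>, so it changes their length by a
    constant.\<close>
  have shift: "\<exists>A'. \<forall>M. p (length (act g [])) @ M \<in> \<Omega> \<longrightarrow>
      (\<exists>M'. length M' = length M \<and> act g (p (length (act g [])) @ M) = A' @ M' \<and> (M = [] \<longrightarrow> M' = []))"
    if g: "g \<in> carrier P" for g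
  proof -
    define j where "j = length (act g [])"
    obtain b' where b': "b' \<in> B" "\<And>M. M \<in> \<Omega> \<Longrightarrow> act g M = foldr (push iv) (act g []) (move b' M)"
      using act_eq_foldr_push'[OF iv g] by blast
    have "length (act g []) \<le> length (move b' (p j))"
      using l by (simp add: length_p j_def)
    then obtain A' where "\<forall>M. foldr (push iv) (act g []) (move b' (p j) @ M) = A' @ M"
      using foldr_push_long by blast
    then have "act g (p j @ M) = A' @ move b' M" if "p j @ M \<in> \<Omega>" for M
      using b'(2)[OF that] by simp
    then show ?thesis unfolding j_def by (metis length_move move_Nil(1))
  qed
  \<comment> \<open>The constant \<open>t\<close> is the amount by which \<open>y\<close> translates
    far along the axis, the difference of the lengths of \<open>A'\<close> and
    \<open>A\<close>.\<close>
  obtain t where t: "\<And>M. M \<in> \<Omega> \<Longrightarrow> prefix (p (length (act y []))) M \<Longrightarrow>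
      int (length (act y M)) = int (length M) + t"
  proof -
    define A where "A = p (length (act y []))"
    obtain A' where A': "\<forall>M. A @ M \<in> \<Omega> \<longrightarrow> (\<exists>M'. length M' = length M \<and> act y (A @ M) = A' @ M')"
      using shift[OF y] unfolding A_def by blast
    have "int (length (act y M)) = int (length M) + (int (length A') - int (length A))"
      if M: "M \<in> \<Omega>" and pre: "prefix A M" for M
    proof -
      obtain N where N: "M = A @ N" using pre by (auto elim: prefixE)
      then obtain M' where "length M' = length N" "act y M = A' @ M'"
        using A' M by blast
      then show ?thesis using N by simp
    qed
    then show ?thesis using that unfolding A_def by blast
  qed
  have y_pow: "y [^] i \<in> carrier P" "x \<otimes> y [^] i = y [^] i \<otimes> x" for i :: nat
  proof -
    show "y [^] i \<in> carrier P" using y by simp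
    show "x \<otimes> y [^] i = y [^] i \<otimes> x"
      using group_commutes_pow[OF _ y x, of i] xy by simp
  qed
  \<comment> \<open>Since \<open>y\<close> commutes with \<open>x\<close>, it keeps far axis points
    close to the same end, so the translations by \<open>t\<close> add up.\<close>
  have length_pow: "\<exists>J. \<forall>j\<ge>J. int (length (act (y [^] i) (p j))) = int (j * l) + int i * t" for i :: nat
  proof (induction i)
    case 0
    then show ?case by (auto simp: act_one p_\<Omega> length_p)
  next
    case (Suc i)
    then obtain J where J: "\<And>j. j \<ge> J \<Longrightarrow> int (length (act (y [^] i) (p j))) = int (j * l) + int i * t"
      by auto
    define D where "D = length (act y []) + length (act (y [^] i) [])"
    have "int (length (act (y [^] Suc i) (p j))) = int (j * l) + int (Suc i) * t" if j: "j \<ge> max J D" for j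
    proof -
      have "prefix (p (length (act y []))) (act (x [^] j) (act (y [^] i) []))"
        using j y_pow by (intro far) (auto simp: D_def act_\<Omega>)
      then have "prefix (p (length (act y []))) (act (y [^] i) (p j))"
        using act_p y_pow by simp
      then have "int (length (act y (act (y [^] i) (p j)))) = int (length (act (y [^] i) (p j))) + t"
        using t y_pow p_\<Omega> act_\<Omega> by blast
      moreover have "act (y [^] Suc i) (p j) = act y (act (y [^] i) (p j))"
        unfolding nat_pow_Suc2[OF y] using y p_\<Omega> by (simp add: act_mult)
      ultimately show ?thesis using J[of j] j by (simp add: algebra_simps)
    qed
    then show ?case by blast
  qed
  \<comment> \<open>These are the positive and negative parts of \<open>t\<close>. Far along the
    axis \<open>y [^] l\<close> translates by \<open>l * t\<close> and \<open>x\<close> by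
    \<open>l\<close>, so in \<open>z\<close> the translations cancel.\<close>
  define a where "a = nat t"
  define a' where "a' = nat (- t)"
  define z where "z = y [^] l \<otimes> x [^] a' \<otimes> inv (x [^] a)"
  have z: "z \<in> carrier P" using x y by (simp add: z_def)
  have z_eq: "z \<otimes> x [^] a = y [^] l \<otimes> x [^] a'" using x y by (simp add: z_def m_assoc)
  have xz: "x \<otimes> z = z \<otimes> x"
  proof -
    have "x \<otimes> inv (x [^] a) = inv (x [^] a) \<otimes> x"
      using x commute_pow[of x a] by (intro commute_inv) auto
    moreover have "x \<otimes> x [^] a' = x [^] a' \<otimes> x" using x commute_pow[of x a'] by simp
    ultimately show ?thesis
      using x y y_pow(2)[of l] unfolding z_def by (intro commute_mult) auto
  qed
  obtain J where J: "\<And>j. j \<ge> J \<Longrightarrow> int (length (act (y [^] l) (p j))) = int (j * l) + int l * t"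
    using length_pow[of l] by auto
  have length_z: "length (act z (p j)) = j * l" if j: "j \<ge> J + a" for j
  proof -
    obtain i where i: "j = i + a" "i \<ge> J"
      using j by (intro that[of "j - a"]) auto
    have "act z (p j) = act (z \<otimes> x [^] a) (p i)"
      using x z p_\<Omega> p_add[of a i] by (simp add: i act_mult add.commute)
    also have "\<dots> = act (y [^] l) (p (a' + i))"
      using x y p_\<Omega> p_add[of a' i] by (simp add: z_eq act_mult)
    finally have "int (length (act z (p j))) = int ((a' + i) * l) + int l * t"
      using J[of "a' + i"] i by simp
    moreover have "int a' + t = int a" by (simp add: a_def a'_def)
    then have "int l * t = int l * int a - int l * int a'" by (metis add_diff_cancel_left' right_diff_distrib)
    ultimately have "int (length (act z (p j))) = int (j * l)" by (simp add: i algebra_simps)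
    then show ?thesis by linarith
  qed
  define A where "A = p (length (act z []))"
  obtain A' where A': "\<And>M. A @ M \<in> \<Omega> \<Longrightarrow>
      \<exists>M'. length M' = length M \<and> act z (A @ M) = A' @ M' \<and> (M = [] \<longrightarrow> M' = [])"
    using shift[OF z] unfolding A_def by blast
  \<comment> \<open>The summand \<open>J + a\<close> makes \<open>length_z\<close> applicable; twice
    the length of \<open>act z []\<close> lets \<open>far\<close> apply to the vertex
    \<open>act z []\<close> with a prefix index of the same size.\<close>
  define j where "j = J + a + 2 * length (act z [])"
  have "prefix A (p j)" unfolding A_def by (rule prefix_p) (simp add: j_def)
  then obtain M where M: "p j = A @ M" by (auto elim: prefixE)
  then obtain M' where M': "length M' = length M" "act z (p j) = A' @ M'"
    using A'[of M] p_\<Omega>[of j] by auto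
  have "length A' = length A"
    using length_z[of j] M' M length_p[of j] by (simp add: j_def)
  moreover have "prefix A (act z (p j))"
    unfolding act_p[OF z xz] A_def using z by (intro far) (auto simp: j_def act_\<Omega>)
  ultimately have "A' = A" using M'(2) by (auto elim!: prefixE simp: append_eq_append_conv)
  then have "act z A = A" using A'[of "[]"] p_\<Omega> by (auto simp: A_def)
  \<comment> \<open>As \<open>z\<close> commutes with \<open>x\<close>, fixing the point
    \<open>A\<close> of the axis means fixing its translate \<open>[]\<close>, and then also
    \<open>n\<close>. So \<open>z\<close> fixes two vertices and thus an edge.\<close>
  then have "act (x [^] length (act z [])) (act z []) = act (x [^] length (act z [])) []"
    using act_p[OF z xz] by (simp add: A_def p_def[symmetric])
  then have base: "act z [] = []"
    using x z act_\<Omega> by (subst (asm) act_eq_iff) auto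
  have "act z n = n"
    using act_p[OF z xz, of 1] x base by (simp add: p_def n_def)
  then have "\<exists>h \<in> carrier P. inv h \<otimes> z \<otimes> h \<in> K"
    using fixed_vertex_conj_K stabilizer_base[OF z base] n_\<Omega> nonempty by (auto simp: n_def)
  then show ?thesis using z z_eq l by blast
qed

proposition commuting_pair:
  assumes iv: "\<not> iv" and x: "x \<in> carrier P" and y: "y \<in> carrier P" and xy: "x \<otimes> y = y \<otimes> x"
  shows "(\<exists>h \<in> carrier P. inv h \<otimes> x \<otimes> h \<in> B) \<or>
    (\<exists>z \<in> carrier P. \<exists>(l::nat) (a::nat) (b::nat). l > 0 \<and> z \<otimes> x [^] a = y [^] l \<otimes> x [^] b \<and>
      (\<exists>h \<in> carrier P. inv h \<otimes> z \<otimes> h \<in> K))"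
proof -
  \<comment> \<open>A conjugate of \<open>x\<close> of least displacement at the base point either
    fixes it or satisfies the minimality that \<open>commuting_axis\<close> requires.\<close>
  obtain h where h: "h \<in> carrier P"
    and min: "\<And>u. u \<in> carrier P \<Longrightarrow>
      length (act (inv h \<otimes> x \<otimes> h) []) \<le> length (act (inv u \<otimes> x \<otimes> u) [])"
    using ex_has_least_nat[of "\<lambda>u. u \<in> carrier P" \<one> "\<lambda>u. length (act (inv u \<otimes> x \<otimes> u) [])"]
    by auto
  let ?x = "inv h \<otimes> x \<otimes> h" and ?y = "inv h \<otimes> y \<otimes> h"
  show ?thesis
  proof (cases "act ?x [] = []")
    case True
    then show ?thesis using h x stabilizer_base[of ?x] by auto
  next
    case False
    have "\<exists>z \<in> carrier P. \<exists>(l::nat) (a::nat) (b::nat). l > 0 \<and> z \<otimes> ?x [^] a = ?y [^] l \<otimes> ?x [^] b \<and>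
      (\<exists>h \<in> carrier P. inv h \<otimes> z \<otimes> h \<in> K)"
    proof (rule commuting_axis[OF iv _ _ _ False])
      show "?x \<otimes> ?y = ?y \<otimes> ?x" using h x y xy by (simp add: conj_mult)
      fix u assume u: "u \<in> carrier P"
      have "inv u \<otimes> ?x \<otimes> u = inv (h \<otimes> u) \<otimes> x \<otimes> (h \<otimes> u)"
        using h x u by (simp add: inv_mult_group m_assoc)
      then show "length (act ?x []) \<le> length (act (inv u \<otimes> ?x \<otimes> u) [])"
        using min[of "h \<otimes> u"] h u by simp
    qed (use h x y in auto)
    then obtain z k and l a b :: nat where z: "z \<in> carrier P" "l > 0"
      "z \<otimes> ?x [^] a = ?y [^] l \<otimes> ?x [^] b" "k \<in> carrier P" "inv k \<otimes> z \<otimes> k \<in> K"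
      by auto
    define z' where "z' = h \<otimes> z \<otimes> inv h"
    have z': "z' \<in> carrier P" "z = inv h \<otimes> z' \<otimes> h"
      using z h by (simp_all add: z'_def m_assoc inv_mult_cancel)
    have "inv h \<otimes> (z' \<otimes> x [^] a) \<otimes> h = inv h \<otimes> (y [^] l \<otimes> x [^] b) \<otimes> h"
      using z(3) h x y z' by (simp add: conj_pow conj_mult)
    then have "z' \<otimes> x [^] a = y [^] l \<otimes> x [^] b"
      using h x y z' by simp
    moreover have "inv k \<otimes> z \<otimes> k = inv (h \<otimes> k) \<otimes> z' \<otimes> (h \<otimes> k)"
      using h z' z(4) by (simp add: inv_mult_group m_assoc)
    then have "\<exists>h \<in> carrier P. inv h \<otimes> z' \<otimes> h \<in> K"
      using z(4,5) h by (intro bexI[of _ "h \<otimes> k"]) auto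
    ultimately show ?thesis
      using z'(1) z(2) by blast
  qed
qed

end

section \<open>Tree actions obtained from presentations\<close>

text \<open>The letter \<open>c\<close> may occur in relators only through commutators with letters
  of \<open>link\<close>, in either order, or through its square if \<open>iv\<close> holds. This is
  the shape of presentation of an HNN extension or amalgam along the subgroup generated by
  \<open>link\<close>.\<close>

locale split_presentation =
  fixes S :: "'g set" and R :: "'g pword set" and c :: 'g and link :: "'g set" and iv :: bool
  assumes c_S: "c \<in> S" and link: "link \<subseteq> S - {c}"
    and rels: "\<lbrakk>r \<in> R; r \<in> pwords S\<rbrakk> \<Longrightarrow> r \<in> pwords (S - {c}) \<or> iv \<and> r = [(c, False), (c, False)] \<or>
      (\<exists>u \<in> link. r = [(u, False), (c, False), (u, True), (c, True)] \<or>
        r = [(c, False), (u, False), (c, True), (u, True)])"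
    and link_c: "u \<in> link \<Longrightarrow>
      pclass S R [(u, False)] \<otimes>\<^bsub>presented_group S R\<^esub> pclass S R [(c, False)]
      = pclass S R [(c, False)] \<otimes>\<^bsub>presented_group S R\<^esub> pclass S R [(u, False)]"
    and iv_rel: "iv \<Longrightarrow> [(c, False), (c, False)] \<in> R"
begin

abbreviation P where "P \<equiv> presented_group S R"
abbreviation cls where "cls \<equiv> pclass S R"
abbreviation B where "B \<equiv> cls ` pwords (S - {c})"
abbreviation K where "K \<equiv> cls ` pwords link"

lemma cls_c_inv: "inv\<^bsub>P\<^esub> cls [(c, False)] = cls [(c, True)]"
  using c_S by (simp add: inv_presented_group word_inv_def)

sublocale split_data P B K "cls [(c, False)]" iv
proof (rule split_data.intro[OF group_presented_group], rule split_data_axioms.intro)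
  show "subgroup B P" "subgroup K P"
    using link by (auto intro!: subgroup_pclass_pwords)
  show "K \<subseteq> B" using link pwords_mono by fastforce
  show "cls [(c, False)] \<in> carrier P" using c_S by simp
next
  fix k assume "k \<in> K"
  then show "k \<otimes>\<^bsub>P\<^esub> cls [(c, False)] = cls [(c, False)] \<otimes>\<^bsub>P\<^esub> k"
    using pclass_words_commute[of link "{c}" S R _ "[(c, False)]"] link link_c c_S by auto
next
  assume iv
  then have "pres_eq S R ([] @ [(c, False), (c, False)] @ []) ([] @ [])"
    using iv_rel c_S by (intro pe_rel) auto
  then show "cls [(c, False)] \<otimes>\<^bsub>P\<^esub> cls [(c, False)] = \<one>\<^bsub>P\<^esub>"
    using c_S by (simp add: mult_presented_group one_presented_group pclass_eq_iff)
next
  have "cls w \<in> generate P (insert (cls [(c, False)]) B)" if "w \<in> pwords S" for w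
    using that
  proof (induction w)
    case Nil
    then show ?case using generate.one[of P] by (simp add: one_presented_group)
  next
    case (Cons l w)
    have "cls [l] \<in> generate P (insert (cls [(c, False)]) B)"
    proof (cases "fst l = c")
      case True
      then have "l = (c, False) \<or> l = (c, True)" by (cases l) auto
      then show ?thesis
        using generate.incl[of "cls [(c, False)]"] generate.inv[of "cls [(c, False)]"] cls_c_inv
        by (metis insertI1)
    next
      case False
      then have "cls [l] \<in> B" using Cons.prems by (intro imageI) auto
      then show ?thesis by (intro generate.incl) simp
    qed
    moreover have "cls w \<in> generate P (insert (cls [(c, False)]) B)" using Cons by simp
    ultimately have "cls [l] \<otimes>\<^bsub>P\<^esub> cls w \<in> generate P (insert (cls [(c, False)]) B)"
      by (rule generate.eng)
    then show ?case using Cons.prems by (simp add: mult_presented_group)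
  qed
  then show "carrier P \<subseteq> generate P (insert (cls [(c, False)]) B)"
    by (auto simp: carrier_presented_group)
qed

definition letter_act :: "'g \<times> bool \<Rightarrow> 'g pword set set letter list \<Rightarrow> 'g pword set set letter list" where
  "letter_act l L = (if fst l = c then push iv (if snd l then flip iv (K, False) else (K, False)) L
     else move (cls [l]) L)"

definition class_act :: "'g pword set \<Rightarrow> 'g pword set set letter list \<Rightarrow> 'g pword set set letter list" where
  "class_act A L = foldr letter_act (SOME w. w \<in> A) L"

lemma cls_letter_B: "\<lbrakk>fst l \<in> S; fst l \<noteq> c\<rbrakk> \<Longrightarrow> cls [l] \<in> B"
  by (intro imageI) auto

lemma letter_act_\<Omega>: "\<lbrakk>fst l \<in> S; L \<in> \<Omega>\<rbrakk> \<Longrightarrow> letter_act l L \<in> \<Omega>"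
  using cls_letter_B[of l] by (auto simp: letter_act_def push_\<Omega> K_coset move_\<Omega>)

lemma foldr_letter_act_\<Omega>: "\<lbrakk>w \<in> pwords S; L \<in> \<Omega>\<rbrakk> \<Longrightarrow> foldr letter_act w L \<in> \<Omega>"
  by (induction w) (auto simp: letter_act_\<Omega>)

lemma letter_act_cancel:
  assumes "g \<in> S" "L \<in> \<Omega>"
  shows "letter_act (g, d) (letter_act (g, \<not> d) L) = L"
proof (cases "g = c")
  case True
  then show ?thesis
    using assms(2) \<Omega>_reduced by (cases d) (auto simp: letter_act_def push_flip_push push_push_flip)
next
  case False
  have B: "cls [(g, d)] \<in> B" "cls [(g, \<not> d)] \<in> B"
    using assms(1) False by (auto intro!: cls_letter_B)
  have "cls [(g, d)] \<otimes>\<^bsub>P\<^esub> cls [(g, \<not> d)] = \<one>\<^bsub>P\<^esub>"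
    using assms(1) pe_cancel[of "[]" S "[]" g R d]
    by (simp add: mult_presented_group one_presented_group pclass_eq_iff)
  then show ?thesis
    using False B assms(2) by (simp add: letter_act_def move_move move_one)
qed

lemma foldr_letter_act_B:
  assumes "w \<in> pwords (S - {c})" "L \<in> \<Omega>"
  shows "foldr letter_act w L = move (cls w) L"
  using assms(1)
proof (induction w)
  case Nil
  then show ?case using assms(2) move_one by (simp add: one_presented_group)
next
  case (Cons l w)
  have "w \<in> pwords S" using Cons.prems pwords_mono by auto
  then have "cls (l # w) = cls [l] \<otimes>\<^bsub>P\<^esub> cls w"
    using Cons.prems by (simp add: mult_presented_group)
  moreover have "cls w \<in> B" "cls [l] \<in> B" using Cons.prems by (auto intro!: imageI)
  ultimately show ?case
    using Cons assms(2) by (simp add: letter_act_def move_move)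
qed

lemma foldr_letter_act_rel:
  assumes "r \<in> R" "r \<in> pwords S" "L \<in> \<Omega>"
  shows "foldr letter_act r L = L"
proof -
  \<comment> \<open>A letter of \<open>link\<close> represents an element of \<open>K\<close>, which
    fixes the coset \<open>K\<close>; hence moving by it commutes with pushing a letter over
    \<open>K\<close>.\<close>
  have swap: "letter_act (u, d) (letter_act (c, e) M) = letter_act (c, e) (letter_act (u, d) M)"
    if u: "u \<in> link" and M: "M \<in> \<Omega>" for u d e M
  proof -
    have "cls [(u, d)] \<in> K" using u by (intro imageI) auto
    then have k: "cls [(u, d)] \<in> K" "cls [(u, d)] \<in> B" using K_B by auto
    have "cls [(u, d)] <#\<^bsub>P\<^esub> K = K" using k by (simp add: coset_eq_K_iff)
    moreover have "u \<noteq> c" using u link by auto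
    ultimately show ?thesis
      using k(2) M by (auto simp: letter_act_def move_push K_coset flip_def)
  qed
  consider "r \<in> pwords (S - {c})" | "iv" "r = [(c, False), (c, False)]"
    | u where "u \<in> link" "r = [(u, False), (c, False), (u, True), (c, True)]"
    | u where "u \<in> link" "r = [(c, False), (u, False), (c, True), (u, True)]"
    using rels[OF assms(1,2)] by blast
  then show ?thesis
  proof cases
    case 1
    have "pres_eq S R ([] @ r @ []) ([] @ [])" using assms by (intro pe_rel) auto
    then have "cls r = \<one>\<^bsub>P\<^esub>" using assms(2) by (simp add: one_presented_group pclass_eq_iff)
    then show ?thesis using 1 assms(3) by (simp add: foldr_letter_act_B move_one)
  next
    case 2
    have "foldr letter_act [(c, False), (c, False)] L = push iv (K, False) (push iv (K, False) L)"
      by (simp add: letter_act_def)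
    moreover have "flip iv (K, False) = (K, False)" using 2(1) by (simp add: flip_def)
    ultimately show ?thesis
      using push_flip_push[OF \<Omega>_reduced[OF assms(3)], of "(K, False)"] 2(2) by simp
  next
    case 3
    then have "u \<in> S" using link by auto
    then show ?thesis
      using 3 assms(3) swap[of u "letter_act (c, True) L" True False] swap[of u L True True]
        swap[of u "letter_act (u, True) (letter_act (c, True) L)" False False]
        letter_act_cancel[of c L False] letter_act_cancel[of u _ False] c_S
      by (simp add: letter_act_\<Omega>)
  next
    case 4
    then have "u \<in> S" using link by auto
    then show ?thesis
      using 4 assms(3) swap[of u "letter_act (u, True) L" False True]
        letter_act_cancel[of c L False] letter_act_cancel[of u L False] c_S
      by (simp add: letter_act_\<Omega>)
  qed
qed

lemma class_act_cls:
  assumes "w \<in> pwords S" "L \<in> \<Omega>"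
  shows "class_act (cls w) L = foldr letter_act w L"
  unfolding class_act_def
  by (rule foldr_some_pclass[OF _ assms(1)], rule foldr_pres_eq[of S \<Omega>])
    (auto intro: letter_act_\<Omega> letter_act_cancel foldr_letter_act_rel assms)

sublocale split_group P B K "cls [(c, False)]" iv class_act
proof
  fix g h L assume "g \<in> carrier P" "h \<in> carrier P" and L: "L \<in> \<Omega>"
  then obtain u v where "u \<in> pwords S" "g = cls u" "v \<in> pwords S" "h = cls v"
    by (auto simp: carrier_presented_group)
  then show "class_act (g \<otimes>\<^bsub>P\<^esub> h) L = class_act g (class_act h L)"
    using L by (simp add: mult_presented_group class_act_cls foldr_letter_act_\<Omega>)
next
  fix b L assume "b \<in> B" and L: "L \<in> \<Omega>"
  then obtain w where w: "w \<in> pwords (S - {c})" "b = cls w" by auto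
  then have "w \<in> pwords S" using pwords_mono by blast
  then show "class_act b L = move b L"
    using w L by (simp add: class_act_cls foldr_letter_act_B)
qed (use c_S in \<open>auto simp: class_act_cls letter_act_def cls_c_inv\<close>)

end

section \<open>Right-angled Artin groups\<close>

lemma pclass_commute_if_commutator_rel:
  assumes "[(a, False), (b, False), (a, True), (b, True)] \<in> R" "a \<in> S" "b \<in> S"
  shows "pclass S R [(a, False)] \<otimes>\<^bsub>presented_group S R\<^esub> pclass S R [(b, False)]
    = pclass S R [(b, False)] \<otimes>\<^bsub>presented_group S R\<^esub> pclass S R [(a, False)]"
proof -
  interpret group "presented_group S R" by (rule group_presented_group)
  have inv: "pclass S R [(g, True)] = inv\<^bsub>presented_group S R\<^esub> pclass S R [(g, False)]"
    if "g \<in> S" for g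
    using that by (simp add: inv_presented_group word_inv_def)
  have "pres_eq S R ([] @ [(a, False), (b, False), (a, True), (b, True)] @ []) ([] @ [])"
    using assms by (intro pe_rel) auto
  then have "pclass S R [(a, False)] \<otimes>\<^bsub>presented_group S R\<^esub> pclass S R [(b, False)]
      \<otimes>\<^bsub>presented_group S R\<^esub> pclass S R [(a, True)] \<otimes>\<^bsub>presented_group S R\<^esub> pclass S R [(b, True)]
      = \<one>\<^bsub>presented_group S R\<^esub>"
    using assms by (simp add: mult_presented_group one_presented_group pclass_eq_iff)
  then show ?thesis
    using assms by (simp add: inv commutator_eq_one_iff)
qed

lemma split_presentation_RAAG:
  assumes "v \<in> V" and E: "\<And>u v. E u v \<Longrightarrow> u \<in> V \<and> v \<in> V \<and> u \<noteq> v \<and> E v u"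
  shows "split_presentation V (RAAG_rels V E) v {u. E u v} False"
proof
  show "v \<in> V" "{u. E u v} \<subseteq> V - {v}" using assms by auto
next
  fix r assume "r \<in> RAAG_rels V E"
  then obtain u w where r: "r = [(u, False), (w, False), (u, True), (w, True)]" "u \<in> V" "w \<in> V" "E u w"
    by (auto simp: RAAG_rels_def)
  consider "u = v" | "w = v" | "u \<noteq> v" "w \<noteq> v" by blast
  then show "r \<in> pwords (V - {v}) \<or> False \<and> r = [(v, False), (v, False)] \<or>
      (\<exists>u\<in>{u. E u v}. r = [(u, False), (v, False), (u, True), (v, True)] \<or>
        r = [(v, False), (u, False), (v, True), (u, True)])"
    using r E by cases auto
next
  fix u assume "u \<in> {u. E u v}"
  then show "pclass V (RAAG_rels V E) [(u, False)] \<otimes>\<^bsub>presented_group V (RAAG_rels V E)\<^esub>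
      pclass V (RAAG_rels V E) [(v, False)] = pclass V (RAAG_rels V E) [(v, False)]
      \<otimes>\<^bsub>presented_group V (RAAG_rels V E)\<^esub> pclass V (RAAG_rels V E) [(u, False)]"
    using E by (intro pclass_commute_if_commutator_rel) (auto simp: RAAG_rels_def)
qed auto

text \<open>Folding this over a word adds the exponent sum of \<open>v\<close> to a counter; it has
  this form so that \<open>foldr_pres_eq\<close> applies.\<close>

definition exponent_letter :: "'v \<Rightarrow> 'v \<times> bool \<Rightarrow> int \<Rightarrow> int" where
  "exponent_letter v l N = N + (if fst l = v then (if snd l then - 1 else 1) else 0)"

lemma foldr_exponent_letter_eq:
  "w \<in> pwords (V - {v}) \<Longrightarrow> foldr (exponent_letter v) w N = N"
  by (induction w) (auto simp: exponent_letter_def)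

lemma foldr_exponent_letter_pres_eq:
  assumes "pres_eq V (RAAG_rels V E) u w"
  shows "foldr (exponent_letter v) u N = foldr (exponent_letter v) w N"
  by (rule foldr_pres_eq[of V UNIV, OF _ _ _ assms]) (auto simp: exponent_letter_def RAAG_rels_def)

text \<open>The exponent sum of \<open>v\<close> is \<open>1\<close> on every conjugate of
  \<open>v\<close> and \<open>0\<close> on words avoiding \<open>v\<close>.\<close>

lemma conj_generator_notin_parabolic:
  assumes "v \<in> V" "h \<in> carrier (RAAG V E)"
  shows "inv\<^bsub>RAAG V E\<^esub> h \<otimes>\<^bsub>RAAG V E\<^esub> pclass V (RAAG_rels V E) [(v, False)] \<otimes>\<^bsub>RAAG V E\<^esub> h
    \<notin> pclass V (RAAG_rels V E) ` pwords (V - {v})"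
proof
  interpret group "RAAG V E" unfolding RAAG_def by (rule group_presented_group)
  let ?c = "pclass V (RAAG_rels V E)"
  assume "inv\<^bsub>RAAG V E\<^esub> h \<otimes>\<^bsub>RAAG V E\<^esub> ?c [(v, False)] \<otimes>\<^bsub>RAAG V E\<^esub> h \<in> ?c ` pwords (V - {v})"
  then obtain b where b: "b \<in> pwords (V - {v})"
    "inv\<^bsub>RAAG V E\<^esub> h \<otimes>\<^bsub>RAAG V E\<^esub> ?c [(v, False)] \<otimes>\<^bsub>RAAG V E\<^esub> h = ?c b" by auto
  obtain w where w: "w \<in> pwords V" "h = ?c w"
    using assms(2) by (auto simp: RAAG_def carrier_presented_group)
  have bV: "b \<in> pwords V" using b(1) pwords_mono by blast
  have v: "?c [(v, False)] \<in> carrier (RAAG V E)" "?c b \<in> carrier (RAAG V E)"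
    using assms(1) bV by (simp_all add: RAAG_def)
  have "?c [(v, False)] \<otimes>\<^bsub>RAAG V E\<^esub> h = h \<otimes>\<^bsub>RAAG V E\<^esub> ?c b"
    using b(2) v assms(2) by (metis inv_closed inv_solve_left m_assoc m_closed)
  then have "pres_eq V (RAAG_rels V E) ([(v, False)] @ w) (w @ b)"
    using w assms(1) bV by (simp add: RAAG_def mult_presented_group pclass_eq_iff)
  from foldr_exponent_letter_pres_eq[OF this, of v 0]
  have "foldr (exponent_letter v) w 0 + 1 = foldr (exponent_letter v) w 0"
    using b(1) by (simp add: foldr_exponent_letter_eq) (simp add: exponent_letter_def)
  then show False by simp
qed

text \<open>
  For a generator \<open>v\<close> with \<open>\<Psi> v \<noteq> 0\<close>, no element of \<open>C\<close> commutes with a conjugate of \<open>v\<close>. Hence \<open>x\<close> fixes a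
  vertex of the tree obtained by splitting along \<open>v\<close>, and elements of \<open>C\<close> linked by a
  chain of commuting elements have the same unique fixed vertex. So \<open>v\<close> fixes that vertex as well.
\<close>

proposition RAAG_obstruction:
  fixes V :: "'v set" and E :: "'v \<Rightarrow> 'v \<Rightarrow> bool" and \<Psi> :: "'v pword set \<Rightarrow> int"
  defines "Q \<equiv> RAAG V E"
  assumes E: "\<And>u v. E u v \<Longrightarrow> u \<in> V \<and> v \<in> V \<and> u \<noteq> v \<and> E v u"
    and hom: "\<And>g h. \<lbrakk>g \<in> carrier Q; h \<in> carrier Q\<rbrakk> \<Longrightarrow> \<Psi> (g \<otimes>\<^bsub>Q\<^esub> h) = \<Psi> g + \<Psi> h"
    and nonzero: "g\<^sub>0 \<in> carrier Q" "\<Psi> g\<^sub>0 \<noteq> 0"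
    and C: "C \<subseteq> carrier Q"
    and C_centralizer: "\<And>q g. \<lbrakk>q \<in> C; g \<in> carrier Q; g \<otimes>\<^bsub>Q\<^esub> q = q \<otimes>\<^bsub>Q\<^esub> g\<rbrakk> \<Longrightarrow> \<Psi> g = 0"
    and x: "x \<in> C" and y: "y \<in> carrier Q" and xy: "x \<otimes>\<^bsub>Q\<^esub> y = y \<otimes>\<^bsub>Q\<^esub> x"
    and xy_centralizer: "\<And>z (l::nat) (a::nat) (b::nat) g. \<lbrakk>z \<in> carrier Q; l > 0;
      z \<otimes>\<^bsub>Q\<^esub> x [^]\<^bsub>Q\<^esub> a = y [^]\<^bsub>Q\<^esub> l \<otimes>\<^bsub>Q\<^esub> x [^]\<^bsub>Q\<^esub> b; g \<in> carrier Q; g \<otimes>\<^bsub>Q\<^esub> z = z \<otimes>\<^bsub>Q\<^esub> g\<rbrakk> \<Longrightarrow> \<Psi> g = 0"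
    and linked: "\<And>U g. \<lbrakk>x \<in> U; \<And>q q'. \<lbrakk>q \<in> U; q \<in> C; q' \<in> C; q \<otimes>\<^bsub>Q\<^esub> q' = q' \<otimes>\<^bsub>Q\<^esub> q\<rbrakk> \<Longrightarrow> q' \<in> U;
      g \<in> carrier Q\<rbrakk> \<Longrightarrow> g \<otimes>\<^bsub>Q\<^esub> x \<otimes>\<^bsub>Q\<^esub> inv\<^bsub>Q\<^esub> g \<in> U"
  shows False
proof -
  interpret Q: group Q unfolding Q_def RAAG_def by (rule group_presented_group)
  let ?c = "pclass V (RAAG_rels V E)"
  have \<Psi>_one: "\<Psi> \<one>\<^bsub>Q\<^esub> = 0" using hom[of "\<one>\<^bsub>Q\<^esub>" "\<one>\<^bsub>Q\<^esub>"] by simp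
  have \<Psi>_inv: "\<Psi> (inv\<^bsub>Q\<^esub> g) = - \<Psi> g" if "g \<in> carrier Q" for g
    using hom[of "inv\<^bsub>Q\<^esub> g" g] that \<Psi>_one by simp
  have "\<exists>v \<in> V. \<Psi> (?c [(v, False)]) \<noteq> 0"
  proof (rule ccontr)
    assume "\<not> ?thesis"
    then have z: "\<Psi> (?c [(v, False)]) = 0" if "v \<in> V" for v using that by blast
    have "\<Psi> (?c w) = 0" if "w \<in> pwords V" for w
      using that
    proof (induction w)
      case Nil
      then show ?case using \<Psi>_one by (simp add: Q_def RAAG_def one_presented_group)
    next
      case (Cons l w)
      obtain u d where l: "l = (u, d)" by (cases l)
      have u: "u \<in> V" using Cons.prems l by simp
      have "?c [(u, True)] = inv\<^bsub>Q\<^esub> ?c [(u, False)]"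
        using u by (simp add: Q_def RAAG_def inv_presented_group word_inv_def)
      then have "\<Psi> (?c [l]) = 0"
        using z[OF u] \<Psi>_inv[of "?c [(u, False)]"] u l by (cases d) (auto simp: Q_def RAAG_def)
      then show ?case
        using Cons hom[of "?c [l]" "?c w"] by (simp add: Q_def RAAG_def mult_presented_group)
    qed
    then show False
      using nonzero by (auto simp: Q_def RAAG_def carrier_presented_group)
  qed
  then obtain v where v: "v \<in> V" "\<Psi> (?c [(v, False)]) \<noteq> 0" by blast
  interpret T: split_presentation V "RAAG_rels V E" v "{u. E u v}" False
    by (rule split_presentation_RAAG[OF v(1) E])
  have TQ: "T.P = Q" by (simp add: Q_def RAAG_def)
  let ?v = "?c [(v, False)]"
  have v_carrier: "?v \<in> carrier Q" using T.c by (simp add: TQ)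
  \<comment> \<open>Everything in \<open>K\<close> commutes with \<open>v\<close>. If a conjugate of
    \<open>q\<close> lay in \<open>K\<close>, then \<open>q\<close> would commute with a conjugate
    of \<open>v\<close>, where \<Psi> takes the nonzero value of \<open>v\<close>.\<close>
  have not_K: "\<not> (\<exists>h \<in> carrier Q. inv\<^bsub>Q\<^esub> h \<otimes>\<^bsub>Q\<^esub> q \<otimes>\<^bsub>Q\<^esub> h \<in> T.K)"
    if q: "q \<in> carrier Q" and cent: "\<And>g. \<lbrakk>g \<in> carrier Q; g \<otimes>\<^bsub>Q\<^esub> q = q \<otimes>\<^bsub>Q\<^esub> g\<rbrakk> \<Longrightarrow> \<Psi> g = 0" for q
  proof
    assume "\<exists>h \<in> carrier Q. inv\<^bsub>Q\<^esub> h \<otimes>\<^bsub>Q\<^esub> q \<otimes>\<^bsub>Q\<^esub> h \<in> T.K"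
    then obtain h where h: "h \<in> carrier Q" "inv\<^bsub>Q\<^esub> h \<otimes>\<^bsub>Q\<^esub> q \<otimes>\<^bsub>Q\<^esub> h \<in> T.K" by blast
    define k where "k = inv\<^bsub>Q\<^esub> h \<otimes>\<^bsub>Q\<^esub> q \<otimes>\<^bsub>Q\<^esub> h"
    have k: "k \<in> carrier Q" "k \<otimes>\<^bsub>Q\<^esub> ?v = ?v \<otimes>\<^bsub>Q\<^esub> k"
      using h q T.K_c[of k] by (simp_all add: k_def TQ)
    have q_eq: "q = inv\<^bsub>Q\<^esub> (inv\<^bsub>Q\<^esub> h) \<otimes>\<^bsub>Q\<^esub> k \<otimes>\<^bsub>Q\<^esub> inv\<^bsub>Q\<^esub> h"
      using h q by (simp add: k_def Q.m_assoc flip: Q.m_assoc[of h "inv\<^bsub>Q\<^esub> h"])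
    let ?g = "inv\<^bsub>Q\<^esub> (inv\<^bsub>Q\<^esub> h) \<otimes>\<^bsub>Q\<^esub> ?v \<otimes>\<^bsub>Q\<^esub> inv\<^bsub>Q\<^esub> h"
    have "?g \<otimes>\<^bsub>Q\<^esub> q = q \<otimes>\<^bsub>Q\<^esub> ?g"
      unfolding q_eq using h k v_carrier by (simp only: Q.conj_mult Q.inv_closed)
    then have "\<Psi> ?g = 0" using h v_carrier by (intro cent) auto
    then show False using h v_carrier v(2) by (simp add: hom \<Psi>_inv)
  qed
  have "\<exists>h \<in> carrier Q. inv\<^bsub>Q\<^esub> h \<otimes>\<^bsub>Q\<^esub> x \<otimes>\<^bsub>Q\<^esub> h \<in> T.B"
  proof (rule ccontr)
    assume "\<not> ?thesis"
    then obtain z and l a b :: nat where z: "z \<in> carrier Q" "l > 0"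
      "z \<otimes>\<^bsub>Q\<^esub> x [^]\<^bsub>Q\<^esub> a = y [^]\<^bsub>Q\<^esub> l \<otimes>\<^bsub>Q\<^esub> x [^]\<^bsub>Q\<^esub> b"
      "\<exists>h \<in> carrier Q. inv\<^bsub>Q\<^esub> h \<otimes>\<^bsub>Q\<^esub> z \<otimes>\<^bsub>Q\<^esub> h \<in> T.K"
      using T.commuting_pair[unfolded TQ, OF _ _ y xy] x C by blast
    show False using not_K[OF z(1) xy_centralizer[OF z(1-3)]] z(4) by blast
  qed
  then obtain h where h: "h \<in> carrier Q" "inv\<^bsub>Q\<^esub> h \<otimes>\<^bsub>Q\<^esub> x \<otimes>\<^bsub>Q\<^esub> h \<in> T.B" by blast
  \<comment> \<open>In terms of the tree, \<open>U\<close> is the stabilizer of the vertex to which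
    \<open>h\<close> carries the base point.\<close>
  define U where "U = {q \<in> carrier Q. inv\<^bsub>Q\<^esub> h \<otimes>\<^bsub>Q\<^esub> q \<otimes>\<^bsub>Q\<^esub> h \<in> T.B}"
  \<comment> \<open>If \<open>g\<close> moved this vertex, \<open>q\<close> would fix a second
    vertex and so an edge, and a conjugate of \<open>q\<close> would lie in
    \<open>K\<close>.\<close>
  have in_B: "inv\<^bsub>Q\<^esub> h \<otimes>\<^bsub>Q\<^esub> g \<otimes>\<^bsub>Q\<^esub> h \<in> T.B"
    if q: "q \<in> C" "q \<in> U" and g: "g \<in> carrier Q" "inv\<^bsub>Q\<^esub> g \<otimes>\<^bsub>Q\<^esub> q \<otimes>\<^bsub>Q\<^esub> g \<in> U" for q g
  proof (rule ccontr)
    let ?g = "inv\<^bsub>Q\<^esub> h \<otimes>\<^bsub>Q\<^esub> g \<otimes>\<^bsub>Q\<^esub> h" and ?q = "inv\<^bsub>Q\<^esub> h \<otimes>\<^bsub>Q\<^esub> q \<otimes>\<^bsub>Q\<^esub> h"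
    assume notin: "?g \<notin> T.B"
    have qQ: "q \<in> carrier Q" using q C by auto
    have "inv\<^bsub>Q\<^esub> ?g = inv\<^bsub>Q\<^esub> h \<otimes>\<^bsub>Q\<^esub> inv\<^bsub>Q\<^esub> g \<otimes>\<^bsub>Q\<^esub> h"
      using h g by (simp add: Q.inv_mult_group Q.m_assoc)
    then have "inv\<^bsub>Q\<^esub> ?g \<otimes>\<^bsub>Q\<^esub> ?q \<otimes>\<^bsub>Q\<^esub> ?g = inv\<^bsub>Q\<^esub> h \<otimes>\<^bsub>Q\<^esub> (inv\<^bsub>Q\<^esub> g \<otimes>\<^bsub>Q\<^esub> q \<otimes>\<^bsub>Q\<^esub> g) \<otimes>\<^bsub>Q\<^esub> h"
      using h g qQ by (simp add: Q.conj_mult)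
    then have "inv\<^bsub>Q\<^esub> ?g \<otimes>\<^bsub>Q\<^esub> ?q \<otimes>\<^bsub>Q\<^esub> ?g \<in> T.B" using g(2) by (simp add: U_def)
    then obtain k where k: "k \<in> carrier Q" "inv\<^bsub>Q\<^esub> k \<otimes>\<^bsub>Q\<^esub> ?q \<otimes>\<^bsub>Q\<^esub> k \<in> T.K"
      using T.conj_in_B[of ?q ?g] q g h notin by (auto simp: U_def TQ)
    have "inv\<^bsub>Q\<^esub> (h \<otimes>\<^bsub>Q\<^esub> k) \<otimes>\<^bsub>Q\<^esub> q \<otimes>\<^bsub>Q\<^esub> (h \<otimes>\<^bsub>Q\<^esub> k) \<in> T.K"
      using k h qQ by (simp add: Q.inv_mult_group Q.m_assoc)
    then show False using not_K[OF qQ C_centralizer[OF q(1)]] h k by blast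
  qed
  have xU: "x \<in> U" using h x C by (auto simp: U_def)
  \<comment> \<open>The inverse of \<open>v\<close> is used because \<open>in_B\<close> asks for
    \<open>x\<close> conjugated in the opposite order to \<open>linked\<close>.\<close>
  have "inv\<^bsub>Q\<^esub> ?v \<otimes>\<^bsub>Q\<^esub> x \<otimes>\<^bsub>Q\<^esub> inv\<^bsub>Q\<^esub> (inv\<^bsub>Q\<^esub> ?v) \<in> U"
  proof (rule linked[OF xU])
    fix q q' assume q: "q \<in> U" "q \<in> C" "q' \<in> C" "q \<otimes>\<^bsub>Q\<^esub> q' = q' \<otimes>\<^bsub>Q\<^esub> q"
    have "q \<in> carrier Q" "q' \<in> carrier Q" using q C by auto
    then have "inv\<^bsub>Q\<^esub> q' \<otimes>\<^bsub>Q\<^esub> q \<otimes>\<^bsub>Q\<^esub> q' = q"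
      using q(4) by (simp add: Q.m_assoc) (simp flip: Q.m_assoc)
    then show "q' \<in> U" using in_B[of q q'] q C by (auto simp: U_def)
  qed (use v_carrier in simp)
  then have "inv\<^bsub>Q\<^esub> ?v \<otimes>\<^bsub>Q\<^esub> x \<otimes>\<^bsub>Q\<^esub> ?v \<in> U" using v_carrier by simp
  then have "inv\<^bsub>Q\<^esub> h \<otimes>\<^bsub>Q\<^esub> ?v \<otimes>\<^bsub>Q\<^esub> h \<in> T.B" using in_B[OF x xU v_carrier] by simp
  then show False
    using conj_generator_notin_parabolic[OF v(1), of h E] h by (simp add: Q_def)
qed

section \<open>Flat braid groups\<close>

lemma adj_transp_adj_transp [simp]: "adj_transp i (adj_transp i x) = x"
  by (simp add: adj_transp_def)

lemma adj_transp_commute: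
  "i + 2 \<le> j \<Longrightarrow> adj_transp i (adj_transp j x) = adj_transp j (adj_transp i x)"
  by (auto simp: adj_transp_def)

text \<open>Every letter, whatever its sign, acts as an involution, so a commutator relator reduces
  to the commutation of two letters, where one may assume \<open>i + 2 \<le> j\<close>.\<close>

lemma foldr_FB_pres_eq:
  assumes eq: "pres_eq (FB_gens n) (FB_rels n) v w"
    and involution: "\<And>i b d t. i \<in> FB_gens n \<Longrightarrow> f (i, b) (f (i, d) t) = t"
    and commute: "\<And>i j b d t. \<lbrakk>i \<in> FB_gens n; j \<in> FB_gens n; i + 2 \<le> j\<rbrakk> \<Longrightarrow>
      f (i, b) (f (j, d) t) = f (j, d) (f (i, b) t)"
  shows "foldr f v t = foldr f w t"
proof (rule foldr_pres_eq[of _ UNIV, OF _ _ _ eq])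
  fix r t assume "r \<in> FB_rels n"
  then consider i where "i \<in> FB_gens n" "r = [(i, False), (i, False)]"
    | i j where "i \<in> FB_gens n" "j \<in> FB_gens n" "r = [(i, False), (j, False), (i, True), (j, True)]"
        "i \<ge> j + 2 \<or> j \<ge> i + 2"
    by (auto simp: FB_rels_def)
  then show "foldr f r t = t"
  proof cases
    case 1
    then show ?thesis using involution by simp
  next
    case 2
    then have "f (j, False) (f (i, True) (f (j, True) t)) = f (i, True) (f (j, False) (f (j, True) t))"
      using commute[of i j] commute[of j i] by auto
    then show ?thesis using 2 involution by simp
  qed
qed (use involution in auto)

lemma perm_of_word_apply: "perm_of_word w x = foldr (\<lambda>l. adj_transp (fst l)) w x"
  by (induction w) (auto simp: perm_of_word_def)

lemma perm_of_word_append: "perm_of_word (u @ v) = perm_of_word u \<circ> perm_of_word v"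
  by (rule ext) (simp add: perm_of_word_apply)

lemma perm_of_word_pres_eq:
  assumes "pres_eq (FB_gens n) (FB_rels n) v w"
  shows "perm_of_word v = perm_of_word w"
proof
  fix x
  show "perm_of_word v x = perm_of_word w x"
    unfolding perm_of_word_apply
    by (rule foldr_FB_pres_eq[OF assms]) (use adj_transp_commute in auto)
qed

text \<open>
  The action records the images \<open>p, q\<close> of \<open>3\<close> and \<open>4\<close> under a suffix of a word together with an integer.
  On pure words the integer is a coordinate of the homomorphism to the fundamental group of the
  finite graph obtained as the quotient by the pure flat braid group of the Bass--Serre tree of the
  amalgam over the parabolic subgroup avoiding both \<open>3\<close> and \<open>4\<close>.
\<close>

definition edge_weight :: "nat \<Rightarrow> nat \<Rightarrow> int" where
  "edge_weight p q = (if q = 4 \<and> p \<in> {1, 2, 3} then 1 else 0)"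

fun edge_act :: "nat \<times> bool \<Rightarrow> nat \<times> nat \<times> int \<Rightarrow> nat \<times> nat \<times> int" where
  "edge_act l (p, q, N) = (adj_transp (fst l) p, adj_transp (fst l) q,
     N + (if fst l = 3 then edge_weight (adj_transp (fst l) p) (adj_transp (fst l) q) - edge_weight p q else 0))"

text \<open>The letters \<open>1\<close> and \<open>2\<close> permute \<open>{1, 2, 3}\<close> and
  fix \<open>4\<close>, and letters from \<open>5\<close> on fix all four points. Hence the letter
  \<open>3\<close>, the only one that changes the counter, commutes in \<open>edge_act\<close> with
  every letter far from it.\<close>

lemma edge_weight_adj_transp:
  assumes "i > 0" "i \<noteq> 3" "i \<noteq> 4"
  shows "edge_weight (adj_transp i p) (adj_transp i q) = edge_weight p q"
proof -
  have i: "i = 1 \<or> i = 2 \<or> i \<ge> 5" using assms by auto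
  from i have "adj_transp i q = 4 \<longleftrightarrow> q = 4"
    by (elim disjE) (simp_all add: adj_transp_def)
  moreover from i have "adj_transp i p \<in> {1, 2, 3} \<longleftrightarrow> p \<in> {1, 2, 3}"
    by (elim disjE) (simp_all add: adj_transp_def)
  ultimately show ?thesis by (simp add: edge_weight_def del: insert_iff)
qed

lemma foldr_edge_act_pres_eq:
  assumes "pres_eq (FB_gens n) (FB_rels n) v w"
  shows "foldr edge_act v t = foldr edge_act w t"
proof (rule foldr_FB_pres_eq[OF assms])
  fix i j :: nat and b d and t :: "nat \<times> nat \<times> int"
  assume ij: "i \<in> FB_gens n" "j \<in> FB_gens n" "i + 2 \<le> j"
  obtain p q N where t: "t = (p, q, N)" by (cases t)
  have weight_i: "edge_weight (adj_transp i p) (adj_transp i q) = edge_weight p q" if "j = 3" for p q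
    using ij that by (intro edge_weight_adj_transp) (auto simp: FB_gens_def)
  have weight_j: "edge_weight (adj_transp j p) (adj_transp j q) = edge_weight p q" if "i = 3" for p q
    using ij that by (intro edge_weight_adj_transp) (auto simp: FB_gens_def)
  show "edge_act (i, b) (edge_act (j, d) t) = edge_act (j, d) (edge_act (i, b) t)"
  proof (cases "j = 3")
    case True
    then show ?thesis
      using weight_i[OF True] adj_transp_commute[OF ij(3), symmetric] ij(3)
      unfolding True t by auto
  next
    case False
    then show ?thesis
      using weight_j adj_transp_commute[OF ij(3)] by (cases "i = 3") (auto simp: t)
  qed
next
  fix i b d and t :: "nat \<times> nat \<times> int"
  show "edge_act (i, b) (edge_act (i, d) t) = t" by (cases t) simp
qed

lemma foldr_edge_act_perm:
  "fst (foldr edge_act w t) = perm_of_word w (fst t)"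
  "fst (snd (foldr edge_act w t)) = perm_of_word w (fst (snd t))"
proof (induction w)
  case (Cons l w)
  {
    case 1
    then show ?case using Cons by (cases "foldr edge_act w t") (auto simp: perm_of_word_apply)
  next
    case 2
    then show ?case using Cons by (cases "foldr edge_act w t") (auto simp: perm_of_word_apply)
  }
qed (simp_all add: perm_of_word_def)

lemma foldr_edge_act_shift:
  "foldr edge_act w (p, q, N + M) = (\<lambda>(p, q, L). (p, q, L + M)) (foldr edge_act w (p, q, N))"
proof (induction w)
  case (Cons l w)
  then show ?case by (cases "foldr edge_act w (p, q, N)") simp
qed simp

lemma foldr_edge_act_avoiding_3:
  "w \<in> pwords (S - {3}) \<Longrightarrow> snd (snd (foldr edge_act w t)) = snd (snd t)"
proof (induction w)
  case (Cons l w)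
  then show ?case by (cases "foldr edge_act w t") auto
qed simp

text \<open>Without the letter \<open>4\<close>, every change of the weight is counted, so the sum
  telescopes. On pure words it vanishes.\<close>

lemma foldr_edge_act_avoiding_4:
  "w \<in> pwords (FB_gens n - {4}) \<Longrightarrow> snd (snd (foldr edge_act w (p, q, N)))
    = N + edge_weight (perm_of_word w p) (perm_of_word w q) - edge_weight p q"
proof (induction w)
  case Nil
  then show ?case by (simp add: perm_of_word_def)
next
  case (Cons l w)
  obtain p' q' N' where e: "foldr edge_act w (p, q, N) = (p', q', N')"
    by (cases "foldr edge_act w (p, q, N)")
  then have pq: "p' = perm_of_word w p" "q' = perm_of_word w q"
    using foldr_edge_act_perm[of w "(p, q, N)"] by simp_all
  have N': "N' = N + edge_weight p' q' - edge_weight p q" using Cons e pq by simp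
  have "perm_of_word (l # w) p = adj_transp (fst l) p'" "perm_of_word (l # w) q = adj_transp (fst l) q'"
    by (simp_all add: pq perm_of_word_apply)
  moreover have "edge_weight (adj_transp (fst l) p') (adj_transp (fst l) q') = edge_weight p' q'"
    if "fst l \<noteq> 3"
    using Cons.prems that by (intro edge_weight_adj_transp) (auto simp: FB_gens_def)
  ultimately show ?case using e N' by auto
qed

lemma foldr_edge_act_pure:
  assumes "w \<in> pwords (FB_gens n - {c})" "c \<in> {3, 4}" "perm_of_word w = id"
  shows "foldr edge_act w t = t"
proof -
  obtain p q N where t: "t = (p, q, N)" by (cases t)
  have "snd (snd (foldr edge_act w t)) = snd (snd t)"
    using assms foldr_edge_act_avoiding_3[of w "FB_gens n" t] foldr_edge_act_avoiding_4[of w n p q N]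
    by (auto simp: t)
  then show ?thesis using foldr_edge_act_perm[of w t] assms(3) by (simp add: prod_eq_iff)
qed

text \<open>This is the homomorphism \<psi> of the introduction. It starts from the positions
  \<open>3\<close> and \<open>4\<close> themselves; pure elements return them there, which makes the
  count additive.\<close>

definition edge_count :: "nat pword set \<Rightarrow> int" where
  "edge_count A = snd (snd (foldr edge_act (SOME w. w \<in> A) (3, 4, 0)))"

text \<open>The infinite dihedral group, onto which the flat braid group retracts via \<open>i\<close> and \<open>i + 1\<close>, acts on the integers.\<close>

fun dihedral_act :: "nat \<Rightarrow> nat \<times> bool \<Rightarrow> int \<Rightarrow> int" where
  "dihedral_act i l x = (if fst l = i then - x else if fst l = Suc i then 1 - x else x)"

definition dihedral_class_act :: "nat \<Rightarrow> nat pword set \<Rightarrow> int \<Rightarrow> int" where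
  "dihedral_class_act i A = foldr (dihedral_act i) (SOME w. w \<in> A)"

definition pure_elements :: "nat \<Rightarrow> nat pword set set" where
  "pure_elements n = {A \<in> carrier (FB n). perm_of_word (SOME w. w \<in> A) = id}"

section \<open>The flat braid group and its pure subgroup\<close>

text \<open>The bound puts the letters \<open>5\<close> and \<open>6\<close> among the generators
  \<open>{1..<n}\<close>.\<close>

locale flat_braid =
  fixes n :: nat
  assumes n: "7 \<le> n"
begin

abbreviation "S \<equiv> FB_gens n"
abbreviation "R \<equiv> FB_rels n"
abbreviation F where "F \<equiv> FB n"
abbreviation fcls where "fcls \<equiv> pclass S R"

sublocale F: group F
  unfolding FB_def by (rule group_presented_group)

lemma carrier_FB: "carrier F = fcls ` pwords S"
  by (simp add: FB_def carrier_presented_group)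

lemma fcls_carrier [simp]: "w \<in> pwords S \<Longrightarrow> fcls w \<in> carrier F"
  by (simp add: FB_def)

lemma mult_fcls: "\<lbrakk>u \<in> pwords S; v \<in> pwords S\<rbrakk> \<Longrightarrow> fcls u \<otimes>\<^bsub>F\<^esub> fcls v = fcls (u @ v)"
  by (simp add: FB_def mult_presented_group)

lemma one_FB: "\<one>\<^bsub>F\<^esub> = fcls []"
  by (simp add: FB_def one_presented_group)

lemma inv_fcls: "w \<in> pwords S \<Longrightarrow> inv\<^bsub>F\<^esub> fcls w = fcls (word_inv w)"
  by (simp add: FB_def inv_presented_group)

lemma perm_some_fcls:
  assumes "w \<in> pwords S"
  shows "perm_of_word (SOME v. v \<in> fcls w) = perm_of_word w"
  using pres_eq_some_in_pclass[OF assms] perm_of_word_pres_eq by metis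

lemma fcls_pure_iff: "w \<in> pwords S \<Longrightarrow> fcls w \<in> pure_elements n \<longleftrightarrow> perm_of_word w = id"
  by (simp add: pure_elements_def perm_some_fcls)

lemma pure_elements_carrier: "A \<in> pure_elements n \<Longrightarrow> A \<in> carrier F"
  by (simp add: pure_elements_def)

lemma pure_elementsE:
  assumes "A \<in> pure_elements n"
  obtains w where "w \<in> pwords S" "A = fcls w"
  using pure_elements_carrier[OF assms] carrier_FB by blast

lemma perm_word_inv:
  assumes "w \<in> pwords S"
  shows "perm_of_word w \<circ> perm_of_word (word_inv w) = id" "perm_of_word (word_inv w) \<circ> perm_of_word w = id"
  using perm_of_word_pres_eq[OF pres_eq_word_inv_right[OF assms]]
    perm_of_word_pres_eq[OF pres_eq_word_inv_left[OF assms]]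
  by (simp_all add: perm_of_word_append) (simp_all add: perm_of_word_def)

lemma perm_conj_eq_id_iff:
  assumes "w \<in> pwords S"
  shows "perm_of_word (w @ j @ word_inv w) = id \<longleftrightarrow> perm_of_word j = id"
proof -
  let ?a = "perm_of_word w" and ?b = "perm_of_word (word_inv w)"
  have "perm_of_word j = ?b \<circ> ?a \<circ> perm_of_word j \<circ> (?b \<circ> ?a)"
    by (simp add: perm_word_inv[OF assms])
  also have "\<dots> = ?b \<circ> (?a \<circ> perm_of_word j \<circ> ?b) \<circ> ?a"
    by (simp add: comp_assoc)
  finally have j: "perm_of_word j = ?b \<circ> (?a \<circ> perm_of_word j \<circ> ?b) \<circ> ?a" .
  have "?a \<circ> perm_of_word j \<circ> ?b = id \<longleftrightarrow> perm_of_word j = id"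
  proof
    assume "?a \<circ> perm_of_word j \<circ> ?b = id"
    with j show "perm_of_word j = id" by (simp add: perm_word_inv[OF assms])
  qed (simp add: perm_word_inv[OF assms])
  then show ?thesis by (simp add: perm_of_word_append comp_assoc)
qed

lemma pure_conj:
  assumes "A \<in> pure_elements n" "g \<in> carrier F"
  shows "g \<otimes>\<^bsub>F\<^esub> A \<otimes>\<^bsub>F\<^esub> inv\<^bsub>F\<^esub> g \<in> pure_elements n"
proof -
  obtain j where j: "j \<in> pwords S" "A = fcls j" using assms(1) by (rule pure_elementsE)
  obtain w where w: "w \<in> pwords S" "g = fcls w" using assms(2) carrier_FB by blast
  have "g \<otimes>\<^bsub>F\<^esub> A \<otimes>\<^bsub>F\<^esub> inv\<^bsub>F\<^esub> g = fcls (w @ j @ word_inv w)"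
    using w j by (simp add: inv_fcls mult_fcls)
  then show ?thesis
    using w j assms(1) perm_conj_eq_id_iff[of w j] by (simp add: fcls_pure_iff)
qed

lemma subgroup_pure: "subgroup (pure_elements n) F"
proof (rule F.subgroupI)
  have "\<one>\<^bsub>F\<^esub> \<in> pure_elements n"
    by (simp add: one_FB fcls_pure_iff) (simp add: perm_of_word_def)
  then show "pure_elements n \<noteq> {}" by blast
next
  fix A assume A: "A \<in> pure_elements n"
  then obtain w where w: "w \<in> pwords S" "A = fcls w" by (rule pure_elementsE)
  then show "inv\<^bsub>F\<^esub> A \<in> pure_elements n"
    using A perm_word_inv(1)[of w] by (simp add: inv_fcls fcls_pure_iff)
  fix A' assume A': "A' \<in> pure_elements n"
  then obtain w' where w': "w' \<in> pwords S" "A' = fcls w'" by (rule pure_elementsE)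
  show "A \<otimes>\<^bsub>F\<^esub> A' \<in> pure_elements n"
    using w w' A A' by (simp add: mult_fcls fcls_pure_iff perm_of_word_append)
qed (auto simp: pure_elements_def)

lemma PFB_eq: "PFB n = F\<lparr>carrier := pure_elements n\<rparr>"
  by (simp add: PFB_def pure_elements_def)

section \<open>The homomorphism to the integers and the dihedral quotients\<close>

lemma edge_count_fcls:
  "w \<in> pwords S \<Longrightarrow> edge_count (fcls w) = snd (snd (foldr edge_act w (3, 4, 0)))"
  unfolding edge_count_def
  by (subst foldr_some_pclass[OF foldr_edge_act_pres_eq]) auto

lemma edge_count_mult:
  assumes "A \<in> pure_elements n" "A' \<in> pure_elements n"
  shows "edge_count (A \<otimes>\<^bsub>F\<^esub> A') = edge_count A + edge_count A'"
proof -
  obtain w where w: "w \<in> pwords S" "A = fcls w" using assms(1) by (rule pure_elementsE)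
  obtain w' where w': "w' \<in> pwords S" "A' = fcls w'" using assms(2) by (rule pure_elementsE)
  note w = w w'
  have "perm_of_word w' = id" using w assms by (simp add: fcls_pure_iff)
  then have "foldr edge_act w' (3, 4, 0) = (3, 4, 0 + edge_count A')"
    using foldr_edge_act_perm[of w' "(3, 4, 0)"] w by (simp add: edge_count_fcls prod_eq_iff)
  then have "edge_count (fcls (w @ w')) = edge_count A + edge_count A'"
    using w foldr_edge_act_shift[of w 3 4 0 "edge_count A'"]
    by (simp add: edge_count_fcls split: prod.splits)
  then show ?thesis using w by (simp add: mult_fcls)
qed

text \<open>Purity is invariant under conjugation, so \<open>j\<close> is pure and acts trivially
  from every starting state, in particular from the one reached by the inverse of \<open>w\<close>.
  What remains is \<open>w\<close> times its inverse.\<close>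

lemma edge_count_conj_avoiding:
  assumes "j \<in> pwords (S - {c})" "c \<in> {3, 4}" "w \<in> pwords S"
    and pure: "fcls w \<otimes>\<^bsub>F\<^esub> fcls j \<otimes>\<^bsub>F\<^esub> inv\<^bsub>F\<^esub> fcls w \<in> pure_elements n"
  shows "edge_count (fcls w \<otimes>\<^bsub>F\<^esub> fcls j \<otimes>\<^bsub>F\<^esub> inv\<^bsub>F\<^esub> fcls w) = 0"
proof -
  have j: "j \<in> pwords S" using assms(1) pwords_mono by blast
  have eq: "fcls w \<otimes>\<^bsub>F\<^esub> fcls j \<otimes>\<^bsub>F\<^esub> inv\<^bsub>F\<^esub> fcls w = fcls (w @ j @ word_inv w)"
    using assms(3) j by (simp add: inv_fcls mult_fcls)
  have "perm_of_word j = id"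
    using pure assms(3) j perm_conj_eq_id_iff[of w j] by (simp add: eq fcls_pure_iff)
  then have "foldr edge_act (w @ j @ word_inv w) t = t" for t
    using foldr_edge_act_pure[OF assms(1,2)] foldr_edge_act_pres_eq[OF pres_eq_word_inv_right[OF assms(3)], of t]
    by simp
  then show ?thesis using assms(3) j by (simp add: eq edge_count_fcls)
qed

lemma dihedral_class_act_fcls:
  assumes "w \<in> pwords S"
  shows "dihedral_class_act i (fcls w) x = foldr (dihedral_act i) w x"
  unfolding dihedral_class_act_def
proof (rule foldr_some_pclass[OF _ assms])
  fix v assume "pres_eq S R w v"
  then show "foldr (dihedral_act i) w x = foldr (dihedral_act i) v x"
    by (rule foldr_FB_pres_eq) auto
qed

lemma dihedral_class_act_mult:
  assumes "A \<in> carrier F" "A' \<in> carrier F"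
  shows "dihedral_class_act i (A \<otimes>\<^bsub>F\<^esub> A') x = dihedral_class_act i A (dihedral_class_act i A' x)"
  using assms by (auto simp: carrier_FB mult_fcls dihedral_class_act_fcls)

section \<open>Splittings of the flat braid group and centralizers of rotations\<close>

abbreviation nbr :: "nat \<Rightarrow> nat set" where
  "nbr c \<equiv> {u \<in> S. u + 2 \<le> c \<or> c + 2 \<le> u}"

lemma split_presentation_FB:
  assumes "c \<in> S"
  shows "split_presentation S R c (nbr c) True"
proof
  fix r assume "r \<in> R" "r \<in> pwords S"
  then consider i where "i \<in> S" "r = [(i, False), (i, False)]"
    | i j where "i \<in> S" "j \<in> S" "r = [(i, False), (j, False), (i, True), (j, True)]"
        "i \<ge> j + 2 \<or> j \<ge> i + 2"
    by (auto simp: FB_rels_def)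
  then show "r \<in> pwords (S - {c}) \<or> True \<and> r = [(c, False), (c, False)] \<or>
      (\<exists>u\<in>nbr c. r = [(u, False), (c, False), (u, True), (c, True)] \<or>
        r = [(c, False), (u, False), (c, True), (u, True)])"
  proof cases
    case 1
    then show ?thesis by auto
  next
    case 2
    consider "i = c" | "j = c" | "i \<noteq> c" "j \<noteq> c" by blast
    then show ?thesis using 2 by cases auto
  qed
next
  fix u assume "u \<in> nbr c"
  then show "pclass S R [(u, False)] \<otimes>\<^bsub>presented_group S R\<^esub> pclass S R [(c, False)]
      = pclass S R [(c, False)] \<otimes>\<^bsub>presented_group S R\<^esub> pclass S R [(u, False)]"
    using assms by (intro pclass_commute_if_commutator_rel) (auto simp: FB_rels_def)
qed (use assms in \<open>auto simp: FB_rels_def\<close>)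

lemma FB_words_commute:
  assumes "\<And>a b. \<lbrakk>a \<in> A; b \<in> B\<rbrakk> \<Longrightarrow> a + 2 \<le> b" "A \<subseteq> S" "B \<subseteq> S" "u \<in> pwords A" "v \<in> pwords B"
  shows "fcls u \<otimes>\<^bsub>F\<^esub> fcls v = fcls v \<otimes>\<^bsub>F\<^esub> fcls u"
  unfolding FB_def
proof (rule pclass_words_commute[OF _ assms(2-)])
  fix a b assume "a \<in> A" "b \<in> B"
  then show "fcls [(a, False)] \<otimes>\<^bsub>presented_group S R\<^esub> fcls [(b, False)]
      = fcls [(b, False)] \<otimes>\<^bsub>presented_group S R\<^esub> fcls [(a, False)]"
    using assms(1-3) by (intro pclass_commute_if_commutator_rel) (auto simp: FB_rels_def)
qed

text \<open>
  The link of \<open>c\<close> contains only one of \<open>i\<close> and \<open>i + 1\<close>, so its image in the infinite dihedral group has order two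
  and contains no conjugate of the rotation given by \<open>y\<close>.
\<close>

lemma centralizer_avoids:
  assumes c: "c \<in> S" and i: "c = i + 2 \<or> i = c + 1"
    and y: "y \<in> fcls ` pwords (S - {c})"
    and rot: "\<And>x. dihedral_class_act i y x = x - m" "m \<noteq> 0"
    and g: "g \<in> carrier F" "g \<otimes>\<^bsub>F\<^esub> y = y \<otimes>\<^bsub>F\<^esub> g"
  shows "g \<in> fcls ` pwords (S - {c})"
proof (rule ccontr)
  assume notin: "g \<notin> fcls ` pwords (S - {c})"
  interpret T: split_presentation S R c "nbr c" True by (rule split_presentation_FB[OF c])
  have TF: "T.P = F" by (simp add: FB_def)
  have yF: "y \<in> carrier F" using y T.B_carrier by (simp add: TF)
  have "inv\<^bsub>F\<^esub> g \<otimes>\<^bsub>F\<^esub> (g \<otimes>\<^bsub>F\<^esub> y) = y" using g(1) yF by (simp flip: F.m_assoc)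
  then have "inv\<^bsub>F\<^esub> g \<otimes>\<^bsub>F\<^esub> y \<otimes>\<^bsub>F\<^esub> g = y" using g(1) yF by (simp add: F.m_assoc g(2))
  then obtain h where h: "h \<in> carrier F" "inv\<^bsub>F\<^esub> h \<otimes>\<^bsub>F\<^esub> y \<otimes>\<^bsub>F\<^esub> h \<in> T.K"
    using T.conj_in_B[unfolded TF, OF y g(1) _ notin] y by auto
  then obtain u where u: "u \<in> pwords (nbr c)" "inv\<^bsub>F\<^esub> h \<otimes>\<^bsub>F\<^esub> y \<otimes>\<^bsub>F\<^esub> h = fcls u" by auto
  have uS: "u \<in> pwords S" using u(1) pwords_mono by blast
  have "(\<forall>x. foldr (dihedral_act i) u x = x) \<or>
      (\<forall>x. foldr (dihedral_act i) u x = (if c = i + 2 then - x else 1 - x))"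
    using u(1) i by (induction u) auto
  then have square: "dihedral_class_act i (fcls u) (dihedral_class_act i (fcls u) x) = x" for x
    using uS by (auto simp: dihedral_class_act_fcls)
  have "h \<otimes>\<^bsub>F\<^esub> fcls u = y \<otimes>\<^bsub>F\<^esub> h"
    unfolding u(2)[symmetric] using h(1) yF by (simp flip: F.m_assoc)
  then have "dihedral_class_act i h (dihedral_class_act i (fcls u) x) = dihedral_class_act i h x - m" for x
    using dihedral_class_act_mult[of h "fcls u" i x] dihedral_class_act_mult[of y h i x] h(1) yF uS rot(1)
    by simp
  \<comment> \<open>Two applications move the value of \<open>h\<close> at \<open>0\<close> by
    \<open>- 2 * m\<close>, whereas the square of \<open>fcls u\<close> acts trivially.\<close>
  from this[of "dihedral_class_act i (fcls u) 0"] this[of 0]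
  show False using square rot(2) by simp
qed

definition rotation :: "nat \<Rightarrow> nat pword set" where
  "rotation i = fcls [(i, False), (Suc i, False)]"

lemma rotation_pow_words:
  assumes "i \<in> A" "Suc i \<in> A" "A \<subseteq> S"
  shows "rotation i [^]\<^bsub>F\<^esub> (k::nat) \<in> fcls ` pwords A"
proof -
  have sub: "subgroup (fcls ` pwords A) F"
    unfolding FB_def by (rule subgroup_pclass_pwords[OF assms(3)])
  have "rotation i \<in> fcls ` pwords A" using assms by (auto simp: rotation_def)
  then show ?thesis
    using subgroup.one_closed[OF sub] subgroup.m_closed[OF sub] by (induction k) auto
qed

lemma rotation_carrier: "\<lbrakk>0 < i; i \<le> 5\<rbrakk> \<Longrightarrow> rotation i \<in> carrier F"
  unfolding rotation_def by (rule fcls_carrier) (use n in \<open>auto simp: FB_gens_def\<close>)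

lemma dihedral_class_act_trivial:
  assumes "A \<in> carrier F" "\<And>x. dihedral_class_act i A x = x"
  shows "dihedral_class_act i (A [^]\<^bsub>F\<^esub> (k::nat)) x = x"
  using assms
  by (induction k arbitrary: x) (auto simp: dihedral_class_act_mult one_FB dihedral_class_act_fcls)

lemma dihedral_class_act_pow:
  assumes "A \<in> carrier F" "\<And>x. dihedral_class_act i A x = x - m"
  shows "dihedral_class_act i (A [^]\<^bsub>F\<^esub> (k::nat)) x = x - m * int k"
  using assms
  by (induction k arbitrary: x)
    (auto simp: dihedral_class_act_mult one_FB dihedral_class_act_fcls algebra_simps)

lemma dihedral_class_act_rotation:
  assumes "0 < i" "i \<le> 5"
  shows "dihedral_class_act i (rotation i) x = x - 1"
  using assms n unfolding rotation_def
  by (subst dihedral_class_act_fcls) (auto simp: FB_gens_def)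

lemma dihedral_class_act_other_rotation:
  assumes "0 < i" "i \<le> 5" "Suc i < j"
  shows "dihedral_class_act j (rotation i) x = x"
  using assms n unfolding rotation_def
  by (subst dihedral_class_act_fcls) (auto simp: FB_gens_def)

text \<open>The product of two adjacent transpositions is a 3-cycle.\<close>

lemma rotation_cube_pure:
  assumes "0 < i" "i \<le> 5"
  shows "rotation i [^]\<^bsub>F\<^esub> (3::nat) \<in> pure_elements n"
proof -
  let ?w = "[(i, False), (Suc i, False), (i, False), (Suc i, False), (i, False), (Suc i, False)]"
  have S: "i \<in> S" "Suc i \<in> S" using assms n by (auto simp: FB_gens_def)
  have "rotation i [^]\<^bsub>F\<^esub> (3::nat) = fcls ?w"
    using S rotation_carrier[OF assms] by (simp add: eval_nat_numeral rotation_def mult_fcls)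
  moreover have "perm_of_word ?w = id"
    by (auto simp: fun_eq_iff perm_of_word_apply adj_transp_def)
  ultimately show ?thesis using S by (simp add: fcls_pure_iff)
qed

text \<open>The rightmost \<open>4\<close> takes the pair \<open>(3, 4)\<close> to one of weight
  \<open>0\<close>, uncounted; the leftmost \<open>3\<close> restores the weight by taking
  \<open>(4, 3)\<close> to \<open>(3, 4)\<close>, and this is counted.\<close>

lemma edge_count_rotation_3: "edge_count (rotation 3 [^]\<^bsub>F\<^esub> (3::nat)) = 1"
proof -
  let ?w = "[(3, False), (4, False), (3, False), (4, False), (3, False), (4, False)] :: nat pword"
  have S: "3 \<in> S" "4 \<in> S" using n by (auto simp: FB_gens_def)
  have "rotation 3 [^]\<^bsub>F\<^esub> (3::nat) = fcls ?w"
    using S rotation_carrier[of 3] by (simp add: eval_nat_numeral rotation_def mult_fcls)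
  then show ?thesis
    using S by (simp add: edge_count_fcls edge_weight_def adj_transp_def)
qed

lemma edge_count_pow:
  assumes "A \<in> pure_elements n"
  shows "edge_count (A [^]\<^bsub>F\<^esub> (k::nat)) = int k * edge_count A"
proof -
  have pow: "A [^]\<^bsub>F\<^esub> (k::nat) \<in> pure_elements n" for k
    using assms subgroup.one_closed[OF subgroup_pure] subgroup.m_closed[OF subgroup_pure]
    by (induction k) auto
  show ?thesis
    using assms pow by (induction k) (auto simp: edge_count_mult one_FB edge_count_fcls algebra_simps)
qed

text \<open>After conjugation by \<open>g\<close>, \<open>centralizer_avoids\<close> represents
  \<open>a\<close> by a word without \<open>c\<close>. So \<open>a\<close> is a pure conjugate of an
  element of a factor.\<close>

lemma edge_count_centralizer:
  assumes c: "c \<in> {3, 4}" "c = i + 2 \<or> i = c + 1"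
    and y: "y \<in> fcls ` pwords (S - {c})"
    and rot: "\<And>x. dihedral_class_act i y x = x - m" "m \<noteq> 0"
    and g: "g \<in> carrier F"
    and a: "a \<in> pure_elements n"
    and comm: "a \<otimes>\<^bsub>F\<^esub> (g \<otimes>\<^bsub>F\<^esub> y \<otimes>\<^bsub>F\<^esub> inv\<^bsub>F\<^esub> g) = (g \<otimes>\<^bsub>F\<^esub> y \<otimes>\<^bsub>F\<^esub> inv\<^bsub>F\<^esub> g) \<otimes>\<^bsub>F\<^esub> a"
  shows "edge_count a = 0"
proof -
  have cS: "c \<in> S" using c n by (auto simp: FB_gens_def)
  have aF: "a \<in> carrier F" by (rule pure_elements_carrier[OF a])
  have yF: "y \<in> carrier F" using y pwords_mono by (fastforce simp: carrier_FB)
  let ?a = "inv\<^bsub>F\<^esub> g \<otimes>\<^bsub>F\<^esub> a \<otimes>\<^bsub>F\<^esub> g"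
  have cancel: "g \<otimes>\<^bsub>F\<^esub> (inv\<^bsub>F\<^esub> g \<otimes>\<^bsub>F\<^esub> b) = b" "inv\<^bsub>F\<^esub> g \<otimes>\<^bsub>F\<^esub> (g \<otimes>\<^bsub>F\<^esub> b) = b"
    if "b \<in> carrier F" for b
    using that g by (simp_all flip: F.m_assoc)
  have y_eq: "inv\<^bsub>F\<^esub> g \<otimes>\<^bsub>F\<^esub> (g \<otimes>\<^bsub>F\<^esub> y \<otimes>\<^bsub>F\<^esub> inv\<^bsub>F\<^esub> g) \<otimes>\<^bsub>F\<^esub> g = y"
    using g yF cancel by (simp add: F.m_assoc)
  have "?a \<otimes>\<^bsub>F\<^esub> y = y \<otimes>\<^bsub>F\<^esub> ?a"
    using F.conj_mult[of g a "g \<otimes>\<^bsub>F\<^esub> y \<otimes>\<^bsub>F\<^esub> inv\<^bsub>F\<^esub> g"]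
      F.conj_mult[of g "g \<otimes>\<^bsub>F\<^esub> y \<otimes>\<^bsub>F\<^esub> inv\<^bsub>F\<^esub> g" a] g aF yF y_eq comm by simp
  then have "?a \<in> fcls ` pwords (S - {c})"
    using centralizer_avoids[OF cS c(2) y rot] g aF by simp
  then obtain j where j: "j \<in> pwords (S - {c})" "?a = fcls j" by auto
  obtain w where w: "w \<in> pwords S" "g = fcls w" using g carrier_FB by blast
  have "a = fcls w \<otimes>\<^bsub>F\<^esub> fcls j \<otimes>\<^bsub>F\<^esub> inv\<^bsub>F\<^esub> fcls w"
    unfolding w(2)[symmetric] j(2)[symmetric] using g aF cancel by (simp add: F.m_assoc)
  then show ?thesis using edge_count_conj_avoiding[OF j(1) c(1) w(1)] a by simp
qed

section \<open>The contradiction for finite-index subgroups\<close>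

lemma not_RAAG:
  assumes H: "subgroup H (PFB n)" and fin: "finite (rcosets\<^bsub>PFB n\<^esub> H)"
    and E: "\<And>u v. E u v \<Longrightarrow> u \<in> V \<and> v \<in> V \<and> u \<noteq> v \<and> E v u"
    and iso: "f \<in> iso (PFB n\<lparr>carrier := H\<rparr>) (RAAG V E)"
  shows False
proof -
  define Q where "Q = RAAG V E"
  interpret Q: group Q unfolding Q_def RAAG_def by (rule group_presented_group)
  have H_F: "subgroup H F"
    using F.incl_subgroup[OF subgroup_pure] H by (simp add: PFB_eq)
  have H_pure: "H \<subseteq> pure_elements n"
    using subgroup.subset[OF H] by (simp add: PFB_eq)
  have H_carrier: "a \<in> H \<Longrightarrow> a \<in> carrier F" for a
    using H_pure pure_elements_carrier by auto
  obtain N :: nat where N: "N > 0" "\<And>g. g \<in> pure_elements n \<Longrightarrow> g [^]\<^bsub>F\<^esub> N \<in> H"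
  proof -
    have "group (PFB n)" using subgroup.subgroup_is_group[OF subgroup_pure F.group_axioms] by (simp add: PFB_eq)
    from group.finite_index_power[OF this H fin] show ?thesis
      using that F.nat_pow_consistent by (auto simp: PFB_eq)
  qed
  have bij: "bij_betw f H (carrier Q)" and f_mult: "\<And>a b. \<lbrakk>a \<in> H; b \<in> H\<rbrakk> \<Longrightarrow> f (a \<otimes>\<^bsub>F\<^esub> b) = f a \<otimes>\<^bsub>Q\<^esub> f b"
    using iso by (auto simp: iso_def hom_def PFB_eq Q_def)
  define e where "e = inv_into H f"
  have e_H: "e q \<in> H" and f_e: "f (e q) = q" if "q \<in> carrier Q" for q
    using that bij unfolding e_def
    by (auto simp: bij_betw_def f_inv_into_f inv_into_into)
  have e_f: "e (f a) = a" if "a \<in> H" for a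
    using that bij unfolding e_def by (auto simp: bij_betw_def)
  have f_Q: "f a \<in> carrier Q" if "a \<in> H" for a using that bij by (auto simp: bij_betw_def)
  have e_mult: "e (p \<otimes>\<^bsub>Q\<^esub> q) = e p \<otimes>\<^bsub>F\<^esub> e q" if "p \<in> carrier Q" "q \<in> carrier Q" for p q
  proof -
    have "f (e p \<otimes>\<^bsub>F\<^esub> e q) = p \<otimes>\<^bsub>Q\<^esub> q" using that by (simp add: f_mult e_H f_e)
    then show ?thesis
      using e_f[of "e p \<otimes>\<^bsub>F\<^esub> e q"] that e_H subgroup.m_closed[OF H_F] by auto
  qed
  interpret e: group_hom Q F e
    by unfold_locales (use e_mult e_H H_carrier in \<open>auto simp: hom_def\<close>)
  \<comment> \<open>The factor \<open>3\<close> makes rotations pure and \<open>N\<close> brings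
    pure elements into \<open>H\<close>, so \<open>H\<close> contains all conjugates of the powers
    below, even by elements outside \<open>H\<close>.\<close>
  define k where "k = 3 * N"
  define x\<^sub>0 where "x\<^sub>0 = rotation 1 [^]\<^bsub>F\<^esub> k"
  define y\<^sub>0 where "y\<^sub>0 = rotation 5 [^]\<^bsub>F\<^esub> k"
  have rot_F: "rotation 1 \<in> carrier F" "rotation 5 \<in> carrier F" by (auto intro: rotation_carrier)
  have x0_F: "x\<^sub>0 \<in> carrier F" and y0_F: "y\<^sub>0 \<in> carrier F" using rot_F by (auto simp: x\<^sub>0_def y\<^sub>0_def)
  have conj_H: "g \<otimes>\<^bsub>F\<^esub> z \<otimes>\<^bsub>F\<^esub> inv\<^bsub>F\<^esub> g \<in> H" if g: "g \<in> carrier F" and z: "z \<in> {x\<^sub>0, y\<^sub>0}" for g z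
  proof -
    obtain i where i: "i \<in> {1, 5}" "z = rotation i [^]\<^bsub>F\<^esub> k" using z by (auto simp: x\<^sub>0_def y\<^sub>0_def)
    have r: "rotation i \<in> carrier F" "rotation i [^]\<^bsub>F\<^esub> (3::nat) \<in> pure_elements n"
      using i rot_F rotation_cube_pure[of i] by auto
    have "g \<otimes>\<^bsub>F\<^esub> z \<otimes>\<^bsub>F\<^esub> inv\<^bsub>F\<^esub> g = (g \<otimes>\<^bsub>F\<^esub> rotation i [^]\<^bsub>F\<^esub> (3::nat) \<otimes>\<^bsub>F\<^esub> inv\<^bsub>F\<^esub> g) [^]\<^bsub>F\<^esub> N"
      using F.conj_pow[of "inv\<^bsub>F\<^esub> g" "rotation i [^]\<^bsub>F\<^esub> (3::nat)" N] g r(1)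
      by (simp add: i(2) k_def F.nat_pow_pow)
    then show ?thesis using N(2) pure_conj[OF r(2) g] by simp
  qed
  have x0_words: "x\<^sub>0 \<in> fcls ` pwords {1, 2}"
    unfolding x\<^sub>0_def by (rule rotation_pow_words) (use n in \<open>auto simp: FB_gens_def\<close>)
  have y0_words: "y\<^sub>0 \<in> fcls ` pwords {5, 6}"
    unfolding y\<^sub>0_def by (rule rotation_pow_words) (use n in \<open>auto simp: FB_gens_def\<close>)
  have avoid: "x\<^sub>0 \<in> fcls ` pwords (S - {3})" "x\<^sub>0 \<in> fcls ` pwords (S - {4})" "y\<^sub>0 \<in> fcls ` pwords (S - {4})"
    unfolding x\<^sub>0_def y\<^sub>0_def by (rule rotation_pow_words; use n in \<open>simp add: FB_gens_def\<close>)+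
  have x0_words': "x\<^sub>0 \<in> fcls ` pwords {1, 2, 3}"
    unfolding x\<^sub>0_def by (rule rotation_pow_words) (use n in \<open>auto simp: FB_gens_def\<close>)
  have comm: "a \<otimes>\<^bsub>F\<^esub> b = b \<otimes>\<^bsub>F\<^esub> a"
    if a: "a \<in> fcls ` pwords {1, 2, 3}" and b: "b \<in> fcls ` pwords {5, 6}" for a b
  proof -
    obtain u where u: "u \<in> pwords {1, 2, 3}" "a = fcls u" using a by blast
    obtain v where v: "v \<in> pwords {5, 6}" "b = fcls v" using b by blast
    show ?thesis unfolding u(2) v(2)
      by (rule FB_words_commute[OF _ _ _ u(1) v(1)]) (use n in \<open>auto simp: FB_gens_def\<close>)
  qed
  have x0_y0: "x\<^sub>0 \<otimes>\<^bsub>F\<^esub> y\<^sub>0 = y\<^sub>0 \<otimes>\<^bsub>F\<^esub> x\<^sub>0"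
    using x0_words' y0_words by (rule comm)
  have rot_x0: "dihedral_class_act 1 x\<^sub>0 x = x - int k" for x
    unfolding x\<^sub>0_def using dihedral_class_act_pow[OF rot_F(1), of 1 1 k]
    by (simp add: dihedral_class_act_rotation)
  have rot_y0: "dihedral_class_act 5 y\<^sub>0 x = x - int k" for x
    unfolding y\<^sub>0_def using dihedral_class_act_pow[OF rot_F(2), of 5 1 k]
    by (simp add: dihedral_class_act_rotation)
  have triv_x0: "dihedral_class_act 5 x\<^sub>0 x = x" for x
    unfolding x\<^sub>0_def using dihedral_class_act_trivial[OF rot_F(1), of 5 k]
    by (simp add: dihedral_class_act_other_rotation)
  have k: "k > 0" using N by (simp add: k_def)
  define C where "C = f ` {g \<otimes>\<^bsub>F\<^esub> z \<otimes>\<^bsub>F\<^esub> inv\<^bsub>F\<^esub> g | g z. g \<in> carrier F \<and> z \<in> {x\<^sub>0, y\<^sub>0}}"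
  have C_I: "f (g \<otimes>\<^bsub>F\<^esub> z \<otimes>\<^bsub>F\<^esub> inv\<^bsub>F\<^esub> g) \<in> C" if "g \<in> carrier F" "z \<in> {x\<^sub>0, y\<^sub>0}" for g z
    using that unfolding C_def by blast
  have x0_H: "x\<^sub>0 \<in> H" and y0_H: "y\<^sub>0 \<in> H"
    using conj_H[of "\<one>\<^bsub>F\<^esub>" x\<^sub>0] conj_H[of "\<one>\<^bsub>F\<^esub>" y\<^sub>0] x0_F y0_F by simp_all
  show False
  proof (rule RAAG_obstruction[of E V "\<lambda>q. edge_count (e q)" "f ((rotation 3 [^]\<^bsub>F\<^esub> (3::nat)) [^]\<^bsub>F\<^esub> N)"
        C "f x\<^sub>0" "f y\<^sub>0", folded Q_def])
    show "\<And>u v. E u v \<Longrightarrow> u \<in> V \<and> v \<in> V \<and> u \<noteq> v \<and> E v u" by (rule E)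
  next
    fix p q assume "p \<in> carrier Q" "q \<in> carrier Q"
    then show "edge_count (e (p \<otimes>\<^bsub>Q\<^esub> q)) = edge_count (e p) + edge_count (e q)"
      using e_H H_pure by (simp add: edge_count_mult subset_iff)
  next
    have pure: "rotation 3 [^]\<^bsub>F\<^esub> (3::nat) \<in> pure_elements n" by (rule rotation_cube_pure) auto
    then have inH: "(rotation 3 [^]\<^bsub>F\<^esub> (3::nat)) [^]\<^bsub>F\<^esub> N \<in> H" by (rule N(2))
    then show "f ((rotation 3 [^]\<^bsub>F\<^esub> (3::nat)) [^]\<^bsub>F\<^esub> N) \<in> carrier Q" by (rule f_Q)
    show "edge_count (e (f ((rotation 3 [^]\<^bsub>F\<^esub> (3::nat)) [^]\<^bsub>F\<^esub> N))) \<noteq> 0"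
      using N(1) by (simp add: e_f[OF inH] edge_count_pow[OF pure] edge_count_rotation_3)
  next
    show "C \<subseteq> carrier Q" using conj_H f_Q by (auto simp: C_def)
  next
    fix q p assume "q \<in> C" and p: "p \<in> carrier Q" "p \<otimes>\<^bsub>Q\<^esub> q = q \<otimes>\<^bsub>Q\<^esub> p"
    then obtain g z where gz: "g \<in> carrier F" "z \<in> {x\<^sub>0, y\<^sub>0}" "q = f (g \<otimes>\<^bsub>F\<^esub> z \<otimes>\<^bsub>F\<^esub> inv\<^bsub>F\<^esub> g)"
      by (auto simp: C_def)
    have eq: "e q = g \<otimes>\<^bsub>F\<^esub> z \<otimes>\<^bsub>F\<^esub> inv\<^bsub>F\<^esub> g" using e_f conj_H gz by simp
    have qQ: "q \<in> carrier Q" using f_Q conj_H gz by simp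
    have "e p \<otimes>\<^bsub>F\<^esub> e q = e q \<otimes>\<^bsub>F\<^esub> e p" using p qQ by (metis e_mult)
    moreover have ep: "e p \<in> pure_elements n" using e_H p H_pure by auto
    \<comment> \<open>Conjugates of \<open>x\<^sub>0\<close> are treated with the splitting along
      \<open>3\<close>, those of \<open>y\<^sub>0\<close> with the splitting along
      \<open>4\<close>.\<close>
    ultimately show "edge_count (e p) = 0"
      using gz(2) k edge_count_centralizer[of 3 1 x\<^sub>0 "int k", OF _ _ avoid(1) rot_x0 _ gz(1) ep]
        edge_count_centralizer[of 4 5 y\<^sub>0 "int k", OF _ _ avoid(3) rot_y0 _ gz(1) ep]
      unfolding eq by auto
  next
    show "f x\<^sub>0 \<in> C" using C_I[of "\<one>\<^bsub>F\<^esub>" x\<^sub>0] x0_F by simp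
    show "f y\<^sub>0 \<in> carrier Q" using y0_H by (rule f_Q)
    show "f x\<^sub>0 \<otimes>\<^bsub>Q\<^esub> f y\<^sub>0 = f y\<^sub>0 \<otimes>\<^bsub>Q\<^esub> f x\<^sub>0"
      using x0_H y0_H x0_y0 by (metis f_mult)
  next
    fix z and l a b :: nat and p
    assume z: "z \<in> carrier Q" "l > 0"
      and eq: "z \<otimes>\<^bsub>Q\<^esub> f x\<^sub>0 [^]\<^bsub>Q\<^esub> a = f y\<^sub>0 [^]\<^bsub>Q\<^esub> l \<otimes>\<^bsub>Q\<^esub> f x\<^sub>0 [^]\<^bsub>Q\<^esub> b"
      and p: "p \<in> carrier Q" "p \<otimes>\<^bsub>Q\<^esub> z = z \<otimes>\<^bsub>Q\<^esub> p"
    have eqF: "e z \<otimes>\<^bsub>F\<^esub> x\<^sub>0 [^]\<^bsub>F\<^esub> a = y\<^sub>0 [^]\<^bsub>F\<^esub> l \<otimes>\<^bsub>F\<^esub> x\<^sub>0 [^]\<^bsub>F\<^esub> b"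
      using arg_cong[OF eq, of e] z f_Q x0_H y0_H by (simp add: e.hom_nat_pow e_f)
    have ez: "e z \<in> carrier F" using z e_H H_carrier by auto
    have sub: "subgroup (fcls ` pwords (S - {4})) F"
      unfolding FB_def by (rule subgroup_pclass_pwords) auto
    have pow: "A [^]\<^bsub>F\<^esub> j \<in> fcls ` pwords (S - {4})" if "A \<in> fcls ` pwords (S - {4})" for A and j :: nat
      using that subgroup.one_closed[OF sub] subgroup.m_closed[OF sub] by (induction j) auto
    have "e z = y\<^sub>0 [^]\<^bsub>F\<^esub> l \<otimes>\<^bsub>F\<^esub> x\<^sub>0 [^]\<^bsub>F\<^esub> b \<otimes>\<^bsub>F\<^esub> inv\<^bsub>F\<^esub> (x\<^sub>0 [^]\<^bsub>F\<^esub> a)"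
      using eqF ez x0_F y0_F by (simp add: F.inv_solve_right)
    then have words: "e z \<in> fcls ` pwords (S - {4})"
      using pow avoid subgroup.m_closed[OF sub] subgroup.m_inv_closed[OF sub] by auto
    \<comment> \<open>Since \<open>x\<^sub>0\<close> acts trivially here, \<open>e z\<close>
      translates as \<open>y\<^sub>0 [^] l\<close> does, by a nonzero amount as \<open>k\<close> and
      \<open>l\<close> are positive.\<close>
    have "dihedral_class_act 5 (e z) x = x - int k * int l" for x
    proof -
      have "dihedral_class_act 5 (e z \<otimes>\<^bsub>F\<^esub> x\<^sub>0 [^]\<^bsub>F\<^esub> a) x = dihedral_class_act 5 (y\<^sub>0 [^]\<^bsub>F\<^esub> l \<otimes>\<^bsub>F\<^esub> x\<^sub>0 [^]\<^bsub>F\<^esub> b) x"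
        by (simp add: eqF)
      then show ?thesis
        using ez x0_F y0_F dihedral_class_act_trivial[OF x0_F triv_x0] dihedral_class_act_pow[OF y0_F rot_y0]
        by (simp add: dihedral_class_act_mult)
    qed
    moreover have "e p \<otimes>\<^bsub>F\<^esub> e z = e z \<otimes>\<^bsub>F\<^esub> e p" using p z by (metis e_mult)
    moreover have "e p \<in> pure_elements n" using e_H p H_pure by auto
    ultimately show "edge_count (e p) = 0"
      using edge_count_centralizer[of 4 5 "e z" "int k * int l" "\<one>\<^bsub>F\<^esub>" "e p"] words k z(2) ez by simp
  next
    fix U p assume xU: "f x\<^sub>0 \<in> U" and p: "p \<in> carrier Q"
      and closed: "\<And>q q'. \<lbrakk>q \<in> U; q \<in> C; q' \<in> C; q \<otimes>\<^bsub>Q\<^esub> q' = q' \<otimes>\<^bsub>Q\<^esub> q\<rbrakk> \<Longrightarrow> q' \<in> U"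
    define xconj where "xconj w = fcls w \<otimes>\<^bsub>F\<^esub> x\<^sub>0 \<otimes>\<^bsub>F\<^esub> inv\<^bsub>F\<^esub> fcls w" for w
    define yconj where "yconj w = fcls w \<otimes>\<^bsub>F\<^esub> y\<^sub>0 \<otimes>\<^bsub>F\<^esub> inv\<^bsub>F\<^esub> fcls w" for w
    have XY: "xconj w \<in> H" "yconj w \<in> H" "f (xconj w) \<in> C" "f (yconj w) \<in> C" if "w \<in> pwords S" for w
      using that conj_H C_I unfolding xconj_def yconj_def by auto
    \<comment> \<open>The chain runs through conjugates by arbitrary words of the flat braid group.
      Appending a letter changes the innermost conjugation, so each step is a fixed link near
      \<open>x\<^sub>0\<close> conjugated by \<open>w\<close>.\<close>
    have "f (xconj w) \<in> U" if "w \<in> pwords S" for w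
      using that
    proof (induction w rule: rev_induct)
      case Nil
      then show ?case using xU x0_F by (simp add: xconj_def flip: one_FB)
    next
      case (snoc l w)
      have w: "w \<in> pwords S" "[l] \<in> pwords S" "fst l \<in> S" using snoc.prems by auto
      define s where "s = fcls [l]"
      have s: "s \<in> carrier F" using w by (simp add: s_def)
      define x\<^sub>1 where "x\<^sub>1 = s \<otimes>\<^bsub>F\<^esub> x\<^sub>0 \<otimes>\<^bsub>F\<^esub> inv\<^bsub>F\<^esub> s"
      have x1: "x\<^sub>1 \<in> carrier F" using s x0_F by (simp add: x\<^sub>1_def)
      have "fcls (w @ [l]) = fcls w \<otimes>\<^bsub>F\<^esub> s" using w by (simp add: s_def mult_fcls)
      then have xconj_snoc: "xconj (w @ [l]) = fcls w \<otimes>\<^bsub>F\<^esub> x\<^sub>1 \<otimes>\<^bsub>F\<^esub> inv\<^bsub>F\<^esub> fcls w"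
        using w s x0_F by (simp add: xconj_def x\<^sub>1_def F.inv_mult_group F.m_assoc)
      have conj_comm: "(fcls w \<otimes>\<^bsub>F\<^esub> a \<otimes>\<^bsub>F\<^esub> inv\<^bsub>F\<^esub> fcls w) \<otimes>\<^bsub>F\<^esub> (fcls w \<otimes>\<^bsub>F\<^esub> b \<otimes>\<^bsub>F\<^esub> inv\<^bsub>F\<^esub> fcls w)
          = (fcls w \<otimes>\<^bsub>F\<^esub> b \<otimes>\<^bsub>F\<^esub> inv\<^bsub>F\<^esub> fcls w) \<otimes>\<^bsub>F\<^esub> (fcls w \<otimes>\<^bsub>F\<^esub> a \<otimes>\<^bsub>F\<^esub> inv\<^bsub>F\<^esub> fcls w)"
        if "a \<otimes>\<^bsub>F\<^esub> b = b \<otimes>\<^bsub>F\<^esub> a" "a \<in> carrier F" "b \<in> carrier F" for a b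
        using F.conj_mult[of "inv\<^bsub>F\<^esub> fcls w" a b] F.conj_mult[of "inv\<^bsub>F\<^esub> fcls w" b a] that w by simp
      show ?case
      \<comment> \<open>For the letters \<open>1\<close>, \<open>2\<close>, \<open>3\<close>, both
        \<open>x\<^sub>0\<close> and its conjugate \<open>x\<^sub>1\<close> commute with
        \<open>y\<^sub>0\<close>, so the chain passes through \<open>yconj w\<close>. Any later
        letter commutes with \<open>x\<^sub>0\<close>, and nothing changes.\<close>
      proof (cases "fst l \<le> 3")
        case True
        then have l: "[l] \<in> pwords {1, 2, 3}" using w(3) by (auto simp: FB_gens_def)
        have sub: "subgroup (fcls ` pwords {1, 2, 3}) F"
          unfolding FB_def by (rule subgroup_pclass_pwords) (use n in \<open>auto simp: FB_gens_def\<close>)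
        have "s \<in> fcls ` pwords {1, 2, 3}" using l by (auto simp: s_def)
        then have "x\<^sub>1 \<in> fcls ` pwords {1, 2, 3}"
          unfolding x\<^sub>1_def using x0_words'
          by (intro subgroup.m_closed[OF sub] subgroup.m_inv_closed[OF sub])
        then have "x\<^sub>1 \<otimes>\<^bsub>F\<^esub> y\<^sub>0 = y\<^sub>0 \<otimes>\<^bsub>F\<^esub> x\<^sub>1" using y0_words by (rule comm)
        then have c1: "yconj w \<otimes>\<^bsub>F\<^esub> xconj (w @ [l]) = xconj (w @ [l]) \<otimes>\<^bsub>F\<^esub> yconj w"
          unfolding xconj_snoc yconj_def using x1 y0_F by (intro conj_comm) auto
        have c2: "xconj w \<otimes>\<^bsub>F\<^esub> yconj w = yconj w \<otimes>\<^bsub>F\<^esub> xconj w"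
          unfolding xconj_def yconj_def using x0_F y0_F x0_y0 by (intro conj_comm) auto
        have "f (xconj w) \<otimes>\<^bsub>Q\<^esub> f (yconj w) = f (yconj w) \<otimes>\<^bsub>Q\<^esub> f (xconj w)"
          using c2 by (simp add: XY[OF w(1)] flip: f_mult)
        then have "f (yconj w) \<in> U" using closed[of "f (xconj w)" "f (yconj w)"] snoc XY[OF w(1)] by simp
        moreover have "f (yconj w) \<otimes>\<^bsub>Q\<^esub> f (xconj (w @ [l])) = f (xconj (w @ [l])) \<otimes>\<^bsub>Q\<^esub> f (yconj w)"
          using c1 by (simp add: XY[OF w(1)] XY[OF snoc.prems] flip: f_mult)
        ultimately show ?thesis
          using closed[of "f (yconj w)" "f (xconj (w @ [l]))"] XY[OF w(1)] XY[OF snoc.prems] by simp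
      next
        case False
        obtain u where u: "u \<in> pwords {1, 2}" "x\<^sub>0 = fcls u" using x0_words by auto
        have "fcls u \<otimes>\<^bsub>F\<^esub> fcls [l] = fcls [l] \<otimes>\<^bsub>F\<^esub> fcls u"
          by (rule FB_words_commute[of "{1, 2}" "{fst l}"]) (use False n w(3) u(1) in \<open>auto simp: FB_gens_def\<close>)
        then have "s \<otimes>\<^bsub>F\<^esub> x\<^sub>0 = x\<^sub>0 \<otimes>\<^bsub>F\<^esub> s" by (simp add: s_def u(2))
        then have "x\<^sub>1 = x\<^sub>0" using s x0_F by (simp add: x\<^sub>1_def F.m_assoc)
        then have "xconj (w @ [l]) = xconj w" using xconj_snoc by (simp add: xconj_def)
        then show ?thesis using snoc w by simp
      qed
    qed
    moreover obtain w where w: "w \<in> pwords S" "e p = fcls w"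
      using e_H[OF p] H_carrier carrier_FB by blast
    moreover have "f (xconj w) = p \<otimes>\<^bsub>Q\<^esub> f x\<^sub>0 \<otimes>\<^bsub>Q\<^esub> inv\<^bsub>Q\<^esub> p"
    proof -
      have "xconj w = e (p \<otimes>\<^bsub>Q\<^esub> f x\<^sub>0 \<otimes>\<^bsub>Q\<^esub> inv\<^bsub>Q\<^esub> p)"
        using p f_Q[OF x0_H] e_f[OF x0_H] by (simp add: xconj_def w(2)[symmetric])
      then show ?thesis
        using f_e[of "p \<otimes>\<^bsub>Q\<^esub> f x\<^sub>0 \<otimes>\<^bsub>Q\<^esub> inv\<^bsub>Q\<^esub> p"] p f_Q[OF x0_H] by (simp del: e.hom_mult)
    qed
    ultimately show "p \<otimes>\<^bsub>Q\<^esub> f x\<^sub>0 \<otimes>\<^bsub>Q\<^esub> inv\<^bsub>Q\<^esub> p \<in> U" by metis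
  qed
qed

end

theorem theorem1p3:
  fixes n :: nat
  assumes "n = 7 \<or> n \<ge> 11"
  shows "\<not> (\<exists>H. subgroup H (PFB n) \<and> finite (RCOSETS (PFB n) H) \<and>
            (\<exists>(V :: nat set) (E :: nat \<Rightarrow> nat \<Rightarrow> bool).
               finite V \<and> (\<forall>u v. E u v \<longrightarrow> u \<in> V \<and> v \<in> V \<and> u \<noteq> v \<and> E v u) \<and>
               ((PFB n) \<lparr> carrier := H \<rparr>) \<cong> RAAG V E))"
proof -
  interpret flat_braid n by unfold_locales (use assms in auto)
  show ?thesis
  proof (intro notI, elim exE conjE)
    fix H V and E :: "nat \<Rightarrow> nat \<Rightarrow> bool"
    assume "subgroup H (PFB n)" "finite (rcosets\<^bsub>PFB n\<^esub> H)" "PFB n\<lparr>carrier := H\<rparr> \<cong> RAAG V E"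
      and E: "\<forall>u v. E u v \<longrightarrow> u \<in> V \<and> v \<in> V \<and> u \<noteq> v \<and> E v u"
    then show False
      using not_RAAG[of H E V] by (meson ex_in_conv is_iso_def)
  qed
qed

end
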